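(* Let $N,M\ge 1$ be integers, and let $\phi$ and $\wp$ be the Kronecker function and the Weierstrass function of one and the same type (elliptic, trigonometric or rational), as defined in the context. Let $R^\hbar_{12}(z)\in \mathrm{Mat}(N,\mathbb{C})^{\otimes 2}$ be a matrix-valued function of complex variables $\hbar$ and $z$ which satisfies (with $z_{ab}=z_a-z_b$) (i) the associative Yang-Baxter equation $$R^\hbar_{12}(z_{12})R^{\eta}_{23}(z_{23})=R^{\eta}_{13}(z_{13})R_{12}^{\hbar-\eta}(z_{12})+R^{\eta-\hbar}_{23}(z_{23})R^\hbar_{13}(z_{13});$$ (ii) the skew-symmetry $R^\hbar_{12}(z)=-R_{21}^{-\hbar}(-z)$; (iii) the unitarity $R^\hbar_{12}(z)R^\hbar_{21}(-z)=(\wp(\hbar)-\wp(z))\,1_N\otimes 1_N$. Define, for $q=(q_1,\dots,q_M)$ and $q_{ij}=q_i-q_j$, $$\mathbf{R}^\hbar_{1'2'12}(z,w\mid q)=\sum_{i=1}^M \stackrel{1'}{E}_{ii}\otimes\stackrel{2'}{E}_{ii}\otimes R^\hbar_{12}(z-w)+\sum_{i\neq j}^M \stackrel{1'}{E}_{ij}\otimes\stackrel{2'}{E}_{ji}\otimes R_{12}^{\,q_{ij}}(z-w)+\sum_{i\neq j}^M \stackrel{1'}{E}_{ii}\otimes\stackrel{2'}{E}_{jj}\otimes \stackrel{1}{1}_{N}\otimes\stackrel{2}{1}_{N}\,\phi(\hbar,-q_{ij}).$$ Then $\mathbf{R}^\hbar$ is a quantum dynamical $R$-matrix, i.e. it satisfies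 the quantum dynamical Yang-Baxter equation $$\mathbf{R}^\hbar_{1'2'12}(z_1,z_2\mid q)\,\mathbf{R}^\hbar_{1'3'13}(z_1,z_3\mid q-\hbar^{(2)})\,\mathbf{R}^\hbar_{2'3'23}(z_2,z_3\mid q)$$ $$=\mathbf{R}^\hbar_{2'3'23}(z_2,z_3\mid q-\hbar^{(1)})\,\mathbf{R}^\hbar_{1'3'13}(z_1,z_3\mid q)\,\mathbf{R}^\hbar_{1'2'12}(z_1,z_2\mid q-\hbar^{(3)}),$$ where the shifts of the arguments $\{q_i\}$ are defined by $$\mathbf{R}^\hbar_{1'2'12}(z_1,z_2\mid q+\hbar^{(3)})=\mathbf{P}_{3'}^\hbar\,\mathbf{R}^\hbar_{1'2'12}(z_1,z_2\mid q)\,\mathbf{P}_{3'}^{-\hbar},$$ $$\mathbf{P}_{3'}^\hbar=\sum_{k=1}^M \stackrel{1'}{1}_{M}\otimes\stackrel{2'}{1}_{M}\otimes\stackrel{3'}{E}_{kk}\otimes\stackrel{1}{1}_{N}\otimes\stackrel{2}{1}_{N}\otimes\stackrel{3}{1}_{N}\,\exp\Big(\hbar\frac{\partial}{\partial q_k}\Big),$$ and similarly for the shifts by $\hbar^{(1)}$ and $\hbar^{(2)}$ (with $E_{kk}$ placed in the component $1'$ or $2'$ respectively), the shifts with a minus sign being obtained by replacing $\hbar$ by $-\hbar$ in the conjugating operators $\mathbf{P}$ only.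
   Context: Matrix notation. $\{e_{ij}\}$ is the standard basis of matrix units in $\mathrm{Mat}(N,\mathbb{C})$, $\{E_{ij}\}$ is the standard basis of matrix units in $\mathrm{Mat}(M,\mathbb{C})$, and $1_N,1_M$ are the identity matrices. The complex variable $\hbar$ is the Planck constant, $z$ is the spectral parameter, and $q_1,\dots,q_M$ are free complex dynamical parameters. Tensor legs. For $R^\hbar_{12}(z)=\sum_{i,j,k,l=1}^N R_{ijkl}(\hbar,z)\,e_{ij}\otimes e_{kl}$ and distinct $a,b\in\{1,2,3\}$, $R^\hbar_{ab}(z)\in\mathrm{Mat}(N,\mathbb{C})^{\otimes 3}$ acts nontrivially only in the $a$-th and $b$-th tensor components: $e_{ij}$ is placed in component $a$, $e_{kl}$ in component $b$, and $1_N$ in the remaining component; e.g. $R^\hbar_{13}(z)=\sum_{i,j,k,l} R_{ijkl}(\hbar,z)\,e_{ij}\otimes 1_N\otimes e_{kl}$. In $\mathrm{Mat}(N,\mathbb{C})^{\otimes 2}$, $R^\hbar_{21}(z)=P_{12}R^\hbar_{12}(z)P_{12}$ with $P_{12}=\sum_{i,j=1}^N e_{ij}\otimes e_{ji}$. $\mathbf{R}^\hbar_{1'2'12}$ takes values in $\mathrm{Mat}(NM,\mathbb{C})^{\otimes 2}\cong\mathrm{Mat}(M,\mathbb{C})^{\otimes 2}\otimes\mathrm{Mat}(N,\mathbb{C})^{\otimes 2}$: the primed numbers $1',2'$ label the $\mathrm{Mat}(M,\mathbb{C})$ tensor components and the unprimed numbers $1,2$ label the $\mathrm{Mat}(N,\mathbb{C})$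 tensor components (the number over a matrix indicates the component in which it stands). In the dynamical Yang-Baxter equation all operators act in $\mathrm{Mat}(M,\mathbb{C})^{\otimes 3}\otimes\mathrm{Mat}(N,\mathbb{C})^{\otimes 3}$, and $\mathbf{R}^\hbar_{a'b'ab}$ acts nontrivially only in the components $a',b'$ and $a,b$, being the identity in the remaining ones. $R_{12}^{\,q_{ij}}(z-w)$ denotes $R_{12}^{\hbar}(z-w)$ with $\hbar$ replaced by $q_{ij}$. Dynamical shifts. $\exp(\hbar\,\partial/\partial q_k)$ is the shift operator $q_k\mapsto q_k+\hbar$ acting on functions of $q$. Explicitly, $\mathbf{R}^\hbar_{a'b'ab}(z_a,z_b\mid q\pm\hbar^{(c)})$, for $c\ne a,b$, equals $\sum_{k=1}^M \stackrel{c'}{E}_{kk}\,\mathbf{R}^\hbar_{a'b'ab}(z_a,z_b\mid q_1,\dots,q_k\pm\hbar,\dots,q_M)$. Functions. In the elliptic case, $$\phi(\hbar,z)=\frac{\vartheta'(0)\vartheta(\hbar+z)}{\vartheta(\hbar)\vartheta(z)},\qquad \vartheta(x)=\sum_{k\in\mathbb{Z}}\exp\Big(\pi\imath\tau\big(k+\tfrac12\big)^2+2\pi\imath\big(x+\tfrac12\big)\big(k+\tfrac12\big)\Big),\qquad \mathrm{Im}(\tau)>0,$$ and $\wp$ is the Weierstrass $\wp$-function (for the lattice $\mathbb{Z}+\tau\mathbb{Z}$). In the trigonometric (hyperbolic) case $\phi(\hbar,z)=\coth(\hbar)+\coth(z)$ and $\wp(x)=1/\sinh^2(x)$. In the rational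 case $\phi(\hbar,z)=\hbar^{-1}+z^{-1}$ and $\wp(x)=1/x^2$. All identities are understood as identities of functions of the complex variables $\hbar,\eta,z_a,q_i$ at generic values (where all terms are defined). *)

theory Defs
  imports "HOL-Analysis.Analysis"
begin

subsection \<open>The Kronecker and Weierstrass functions\<close>

text \<open>The modular parameter of the elliptic case is carried by the constructor.\<close>

datatype fun_type = Elliptic complex | Trigonometric | Rational

fun admissible :: "fun_type \<Rightarrow> bool" where
  "admissible (Elliptic \<tau>) \<longleftrightarrow> Im \<tau> > 0"
| "admissible Trigonometric \<longleftrightarrow> True"
| "admissible Rational \<longleftrightarrow> True"

definition theta :: "complex \<Rightarrow> complex \<Rightarrow> complex" where
  "theta \<tau> x = (\<Sum>\<^sub>\<infinity>k\<in>(UNIV :: int set).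
     exp (of_real pi * \<i> * \<tau> * (of_int k + 1/2)^2
          + 2 * of_real pi * \<i> * (x + 1/2) * (of_int k + 1/2)))"

fun kronecker_phi :: "fun_type \<Rightarrow> complex \<Rightarrow> complex \<Rightarrow> complex" where
  "kronecker_phi (Elliptic \<tau>) h z =
     deriv (theta \<tau>) 0 * theta \<tau> (h + z) / (theta \<tau> h * theta \<tau> z)"
| "kronecker_phi Trigonometric h z = cosh h / sinh h + cosh z / sinh z"
| "kronecker_phi Rational h z = inverse h + inverse z"

definition lattice_point :: "complex \<Rightarrow> int \<times> int \<Rightarrow> complex" where
  "lattice_point \<tau> = (\<lambda>(m, n). of_int m + of_int n * \<tau>)"

fun weierstrass_p :: "fun_type \<Rightarrow> complex \<Rightarrow> complex" where
  "weierstrass_p (Elliptic \<tau>) x =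
     1 / x^2 + (\<Sum>\<^sub>\<infinity>p\<in>UNIV - {(0, 0)}.
       1 / (x - lattice_point \<tau> p)^2 - 1 / (lattice_point \<tau> p)^2)"
| "weierstrass_p Trigonometric x = 1 / (sinh x)^2"
| "weierstrass_p Rational x = 1 / x^2"

text \<open>
  The common set of poles: \<open>weierstrass_p\<close> is defined off this set, and
  \<open>kronecker_phi\<close> is defined when both of its arguments lie off this set.
\<close>

fun pole_set :: "fun_type \<Rightarrow> complex set" where
  "pole_set (Elliptic \<tau>) = range (lattice_point \<tau>)"
| "pole_set Trigonometric = {x. sinh x = 0}"
| "pole_set Rational = {0}"


subsection \<open>Matrices and tensor legs\<close>

type_synonym 'i cmat = "complex ^ 'i ^ 'i"

definition smult_mat :: "complex \<Rightarrow> 'i::finite cmat \<Rightarrow> 'i cmat" (infixr "*\<^sub>m" 75) where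
  "c *\<^sub>m A = (\<chi> a b. c * A $ a $ b)"

definition munit :: "'i::finite \<Rightarrow> 'i \<Rightarrow> 'i cmat" where
  "munit i j = (\<chi> a b. if a = i \<and> b = j then 1 else 0)"

definition tens :: "'i::finite cmat \<Rightarrow> 'k::finite cmat \<Rightarrow> ('i \<times> 'k) cmat"
    (infixr "\<otimes>\<^sub>m" 80) where
  "A \<otimes>\<^sub>m B = (\<chi> a b. A $ fst a $ fst b * B $ snd a $ snd b)"

text \<open>
  In the index convention of \<open>tens\<close>, the coefficient of
  \<open>munit i j \<otimes>\<^sub>m munit k l\<close> in \<open>A\<close> is \<open>A $ (i, k) $ (j, l)\<close>.
\<close>

definition leg12 :: "('n::finite \<times> 'n) cmat \<Rightarrow> ('n \<times> 'n \<times> 'n) cmat" where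
  "leg12 A = (\<Sum>(i, j, k, l)\<in>UNIV.
     A $ (i, k) $ (j, l) *\<^sub>m (munit i j \<otimes>\<^sub>m munit k l \<otimes>\<^sub>m mat 1))"

definition leg13 :: "('n::finite \<times> 'n) cmat \<Rightarrow> ('n \<times> 'n \<times> 'n) cmat" where
  "leg13 A = (\<Sum>(i, j, k, l)\<in>UNIV.
     A $ (i, k) $ (j, l) *\<^sub>m (munit i j \<otimes>\<^sub>m mat 1 \<otimes>\<^sub>m munit k l))"

definition leg23 :: "('n::finite \<times> 'n) cmat \<Rightarrow> ('n \<times> 'n \<times> 'n) cmat" where
  "leg23 A = (\<Sum>(i, j, k, l)\<in>UNIV.
     A $ (i, k) $ (j, l) *\<^sub>m (mat 1 \<otimes>\<^sub>m munit i j \<otimes>\<^sub>m munit k l))"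

definition perm_mat :: "('n::finite \<times> 'n) cmat" where
  "perm_mat = (\<Sum>(i, j)\<in>UNIV. munit i j \<otimes>\<^sub>m munit j i)"

definition leg21 :: "('n::finite \<times> 'n) cmat \<Rightarrow> ('n \<times> 'n) cmat" where
  "leg21 A = perm_mat ** A ** perm_mat"


subsection \<open>The dynamical R-matrix\<close>

definition dynR :: "fun_type \<Rightarrow> (complex \<Rightarrow> complex \<Rightarrow> ('n::finite \<times> 'n) cmat) \<Rightarrow>
    complex \<Rightarrow> complex \<Rightarrow> complex \<Rightarrow> complex ^ 'm::finite \<Rightarrow>
    (('m \<times> 'm) \<times> ('n \<times> 'n)) cmat" where
  "dynR \<kappa> R h z w q =
     (\<Sum>i\<in>UNIV. (munit i i \<otimes>\<^sub>m munit i i) \<otimes>\<^sub>m R h (z - w))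
   + (\<Sum>(i, j)\<in>{(i, j). i \<noteq> j}.
        (munit i j \<otimes>\<^sub>m munit j i) \<otimes>\<^sub>m R (q $ i - q $ j) (z - w))
   + (\<Sum>(i, j)\<in>{(i, j). i \<noteq> j}.
        kronecker_phi \<kappa> h (- (q $ i - q $ j)) *\<^sub>m
          ((munit i i \<otimes>\<^sub>m munit j j) \<otimes>\<^sub>m (mat 1 \<otimes>\<^sub>m mat 1)))"

text \<open>
  All terms of \<open>dynR \<kappa> R h z w q\<close> are defined, where \<open>D\<close> is the set of pairs
  \<open>(h, z)\<close> at which \<open>R h z\<close> is defined.
\<close>

definition dynR_defined :: "fun_type \<Rightarrow> (complex \<times> complex) set \<Rightarrow>
    complex \<Rightarrow> complex \<Rightarrow> complex \<Rightarrow> complex ^ 'm::finite \<Rightarrow> bool" where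
  "dynR_defined \<kappa> D h z w q \<longleftrightarrow>
     (h, z - w) \<in> D \<and>
     (\<forall>i j. i \<noteq> j \<longrightarrow>
        (q $ i - q $ j, z - w) \<in> D \<and> h \<notin> pole_set \<kappa> \<and> - (q $ i - q $ j) \<notin> pole_set \<kappa>)"

text \<open>
  The embeddings \<open>X\<^sub>1\<^sub>'\<^sub>2\<^sub>'\<^sub>1\<^sub>2\<close> etc.; the coefficient of
  \<open>(munit i j \<otimes>\<^sub>m munit k l) \<otimes>\<^sub>m (munit a b \<otimes>\<^sub>m munit c d)\<close> in \<open>X\<close> is
  \<open>X $ ((i, k), (a, c)) $ ((j, l), (b, d))\<close>.
\<close>

definition dleg12 :: "(('m::finite \<times> 'm) \<times> ('n::finite \<times> 'n)) cmat \<Rightarrow>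
    (('m \<times> 'm \<times> 'm) \<times> ('n \<times> 'n \<times> 'n)) cmat" where
  "dleg12 X = (\<Sum>((i, j, k, l), (a, b, c, d))\<in>UNIV.
     X $ ((i, k), (a, c)) $ ((j, l), (b, d)) *\<^sub>m
       ((munit i j \<otimes>\<^sub>m munit k l \<otimes>\<^sub>m mat 1) \<otimes>\<^sub>m (munit a b \<otimes>\<^sub>m munit c d \<otimes>\<^sub>m mat 1)))"

definition dleg13 :: "(('m::finite \<times> 'm) \<times> ('n::finite \<times> 'n)) cmat \<Rightarrow>
    (('m \<times> 'm \<times> 'm) \<times> ('n \<times> 'n \<times> 'n)) cmat" where
  "dleg13 X = (\<Sum>((i, j, k, l), (a, b, c, d))\<in>UNIV.
     X $ ((i, k), (a, c)) $ ((j, l), (b, d)) *\<^sub>m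
       ((munit i j \<otimes>\<^sub>m mat 1 \<otimes>\<^sub>m munit k l) \<otimes>\<^sub>m (munit a b \<otimes>\<^sub>m mat 1 \<otimes>\<^sub>m munit c d)))"

definition dleg23 :: "(('m::finite \<times> 'm) \<times> ('n::finite \<times> 'n)) cmat \<Rightarrow>
    (('m \<times> 'm \<times> 'm) \<times> ('n \<times> 'n \<times> 'n)) cmat" where
  "dleg23 X = (\<Sum>((i, j, k, l), (a, b, c, d))\<in>UNIV.
     X $ ((i, k), (a, c)) $ ((j, l), (b, d)) *\<^sub>m
       ((mat 1 \<otimes>\<^sub>m munit i j \<otimes>\<^sub>m munit k l) \<otimes>\<^sub>m (mat 1 \<otimes>\<^sub>m munit a b \<otimes>\<^sub>m munit c d)))"


subsection \<open>Dynamical shifts\<close>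

definition E1 :: "'m::finite \<Rightarrow> (('m \<times> 'm \<times> 'm) \<times> ('n::finite \<times> 'n \<times> 'n)) cmat" where
  "E1 k = (munit k k \<otimes>\<^sub>m mat 1 \<otimes>\<^sub>m mat 1) \<otimes>\<^sub>m (mat 1 \<otimes>\<^sub>m mat 1 \<otimes>\<^sub>m mat 1)"

definition E2 :: "'m::finite \<Rightarrow> (('m \<times> 'm \<times> 'm) \<times> ('n::finite \<times> 'n \<times> 'n)) cmat" where
  "E2 k = (mat 1 \<otimes>\<^sub>m munit k k \<otimes>\<^sub>m mat 1) \<otimes>\<^sub>m (mat 1 \<otimes>\<^sub>m mat 1 \<otimes>\<^sub>m mat 1)"

definition E3 :: "'m::finite \<Rightarrow> (('m \<times> 'm \<times> 'm) \<times> ('n::finite \<times> 'n \<times> 'n)) cmat" where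
  "E3 k = (mat 1 \<otimes>\<^sub>m mat 1 \<otimes>\<^sub>m munit k k) \<otimes>\<^sub>m (mat 1 \<otimes>\<^sub>m mat 1 \<otimes>\<^sub>m mat 1)"

text \<open>
  \<open>dyn_shift Ec h F q\<close> is \<open>F (q + h\<^sup>(\<^sup>c\<^sup>))\<close> for \<open>Ec = E1, E2, E3\<close>. It is the conjugate of
  multiplication by \<open>F\<close> with the operator \<open>dyn_P Ec h\<close> acting on vector-valued functions
  of \<open>q\<close>; see \<open>dyn_shift_legs\<close> below.
\<close>

definition dyn_shift :: "('m::finite \<Rightarrow> 'i::finite cmat) \<Rightarrow> complex \<Rightarrow>
    (complex ^ 'm \<Rightarrow> 'i cmat) \<Rightarrow> complex ^ 'm \<Rightarrow> 'i cmat" where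
  "dyn_shift Ec h F q = (\<Sum>k\<in>UNIV. Ec k ** F (q + axis k h))"

definition dyn_P :: "('m::finite \<Rightarrow> 'i::finite cmat) \<Rightarrow> complex \<Rightarrow>
    (complex ^ 'm \<Rightarrow> complex ^ 'i) \<Rightarrow> complex ^ 'm \<Rightarrow> complex ^ 'i" where
  "dyn_P Ec h f q = (\<Sum>k\<in>UNIV. Ec k *v f (q + axis k h))"

lemma tens_mult: "(A \<otimes>\<^sub>m B) ** (C \<otimes>\<^sub>m D) = (A ** C) \<otimes>\<^sub>m (B ** D)"
  by (simp add: tens_def matrix_matrix_mult_def vec_eq_iff sum_product sum.cartesian_product
      UNIV_Times_UNIV [symmetric] split_beta mult_ac del: UNIV_Times_UNIV)

lemma tens_one: "mat 1 \<otimes>\<^sub>m mat 1 = mat 1"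
  by (auto simp: tens_def mat_def vec_eq_iff prod_eq_iff)

lemma tens_zero: "0 \<otimes>\<^sub>m B = 0" "A \<otimes>\<^sub>m 0 = 0"
  by (auto simp: tens_def vec_eq_iff)

lemma munit_mult: "munit i j ** munit k l = (if j = k then munit i l else 0)"
proof -
  have "(\<Sum>c\<in>UNIV. (if a = i \<and> c = j then 1 else 0) * (if c = k \<and> b = l then 1 else 0 :: complex))
      = (if j = k \<and> a = i \<and> b = l then 1 else 0)" for a b
    by (subst sum.cong [OF refl, of _ _ "\<lambda>c. if c = j then (if j = k \<and> a = i \<and> b = l then 1 else 0) else 0"])
      auto
  then show ?thesis
    by (auto simp: munit_def matrix_matrix_mult_def vec_eq_iff)
qed

lemma Ec_mult:
  "E1 k ** E1 l = (if k = l then E1 k else 0)"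
  "E2 k ** E2 l = (if k = l then E2 k else 0)"
  "E3 k ** E3 l = (if k = l then E3 k else 0)"
  by (simp_all add: E1_def E2_def E3_def tens_mult munit_mult tens_zero)

lemma smult_mult: "(c *\<^sub>m A) ** B = c *\<^sub>m (A ** B)" "A ** (c *\<^sub>m B) = c *\<^sub>m (A ** B)"
  by (simp_all add: smult_mat_def matrix_matrix_mult_def vec_eq_iff sum_distrib_left mult_ac)

lemma sum_mult: "(\<Sum>x\<in>S. f x) ** B = (\<Sum>x\<in>S. f x ** B)"
    "B ** (\<Sum>x\<in>S. f x) = (\<Sum>x\<in>S. B ** f x)" for f :: "'a \<Rightarrow> 'i::finite cmat"
  by (simp_all add: matrix_matrix_mult_def vec_eq_iff sum_distrib_left sum_distrib_right
      sum.swap [of _ S])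

lemma dleg_commute:
  "dleg12 X ** E3 k = E3 k ** dleg12 X"
  "dleg13 X ** E2 k = E2 k ** dleg13 X"
  "dleg23 X ** E1 k = E1 k ** dleg23 X"
  by (simp_all add: dleg12_def dleg13_def dleg23_def E1_def E2_def E3_def
      sum_mult smult_mult tens_mult split_beta)

lemma dyn_shift_conj:
  assumes orth: "\<And>k l. Ec k ** Ec l = (if k = l then Ec k else 0)"
    and comm: "\<And>q k. F q ** Ec k = Ec k ** F q"
  shows "dyn_P Ec h (\<lambda>q. F q *v dyn_P Ec (- h) f q) q = dyn_shift Ec h F q *v f q"
proof -
  have vsum: "B *v (\<Sum>x\<in>S. g x) = (\<Sum>x\<in>S. B *v g x)"
    for B :: "'b cmat" and g :: "'a \<Rightarrow> complex ^ 'b" and S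
    by (induction S rule: infinite_finite_induct) (simp_all add: matrix_vector_right_distrib)
  have msum: "(\<Sum>x\<in>S. G x) *v v = (\<Sum>x\<in>S. G x *v v)"
    for G :: "'a \<Rightarrow> 'b cmat" and v and S
    by (induction S rule: infinite_finite_induct) (simp_all add: matrix_vector_mult_add_rdistrib)
  have absorb: "Ec k *v (F p *v (\<Sum>l\<in>UNIV. Ec l *v f (p + axis l (- h)))) =
        Ec k *v (F p *v f (p + axis k (- h)))" for k p
  proof -
    have "Ec k *v (F p *v (\<Sum>l\<in>UNIV. Ec l *v f (p + axis l (- h)))) =
          (\<Sum>l\<in>UNIV. (F p ** (Ec k ** Ec l)) *v f (p + axis l (- h)))"
      by (simp add: vsum matrix_vector_mul_assoc matrix_mul_assoc comm [symmetric])
    also have "\<dots> = (\<Sum>l\<in>UNIV. if k = l then (F p ** Ec k) *v f (p + axis k (- h)) else 0)"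
      by (intro sum.cong) (auto simp: orth)
    also have "\<dots> = Ec k *v (F p *v f (p + axis k (- h)))"
      by (simp add: matrix_vector_mul_assoc comm)
    finally show ?thesis .
  qed
  have "Ec k *v (F (q + axis k h) *v (\<Sum>l\<in>UNIV. Ec l *v f (q + axis k h + axis l (- h)))) =
        Ec k *v (F (q + axis k h) *v f q)" for k
  proof -
    have "q + axis k h + axis k (- h) = q"
      by (simp add: axis_def vec_eq_iff)
    with absorb [of k "q + axis k h"] show ?thesis by simp
  qed
  then show ?thesis
    by (simp add: dyn_P_def dyn_shift_def msum matrix_vector_mul_assoc)
qed

corollary dyn_shift_legs:
  "dyn_P E3 h (\<lambda>q. dleg12 (F q) *v dyn_P E3 (- h) f q) q =
     dyn_shift E3 h (\<lambda>q. dleg12 (F q)) q *v f q"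
  "dyn_P E2 h (\<lambda>q. dleg13 (F q) *v dyn_P E2 (- h) f q) q =
     dyn_shift E2 h (\<lambda>q. dleg13 (F q)) q *v f q"
  "dyn_P E1 h (\<lambda>q. dleg23 (F q) *v dyn_P E1 (- h) f q) q =
     dyn_shift E1 h (\<lambda>q. dleg23 (F q)) q *v f q"
  by (intro dyn_shift_conj; simp add: Ec_mult dleg_commute)+

end

theory Submission
  imports Defs "HOL-Real_Asymp.Real_Asymp" "HOL-Complex_Analysis.Complex_Analysis"
begin

text \<open>
  Compared block by block over the dynamical indices, the dynamical Yang-Baxter equation
  splits into the associative Yang-Baxter equation, its image under the exchange of the last two tensor
  components, and the cubic relation
  \<open>R\<^sub>1\<^sub>2(x) R\<^sub>1\<^sub>3(y) R\<^sub>2\<^sub>3(x) - R\<^sub>2\<^sub>3(y) R\<^sub>1\<^sub>3(x) R\<^sub>1\<^sub>2(y) = (\<wp>(x) - \<wp>(y)) R\<^sub>1\<^sub>3(x + y)\<close>,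
  which follows from the first two and unitarity. The scalar terms match because
  \<open>\<phi>(h, y) \<phi>(h, -y) = \<wp>(h) - \<wp>(y)\<close>. In the elliptic case this identity holds because theta
  functions of second order form a two-dimensional space, spanned by \<open>\<theta>(x)\<^sup>2\<close> and \<open>\<wp>(x) \<theta>(x)\<^sup>2\<close>,
  which contains \<open>\<theta>(x + y) \<theta>(x - y)\<close>. The derivations of the relations for \<open>R\<close> need values of \<open>R\<close> at
  points that do not occur in the relations themselves, so they are carried out on an open dense set
  and extended by continuity.
\<close>

subsection \<open>Fourier coefficients of periodic entire functions\<close>

text \<open>The elliptic case works with entire functions and Fourier coefficients only. Translation
  by \<tau> ties the coefficient \<open>n\<close> of a second-order theta function to the
  coefficient \<open>n + 2\<close>, so two coefficients determine it; the two basis functions are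
  independent because of the double pole of \<wp> at 0. That theta vanishes only on the lattice is a
  by-product: a zero elsewhere would be a common zero of the basis, hence of every product
  \<open>theta \<tau> (y + a) * theta \<tau> (y - a)\<close>. The cubic relation rests on the fact
  that skew-symmetry and unitarity together make \<open>R h z ** R (- h) z\<close> a scalar.
  Multiplying the exchanged equation by one more factor creates two such scalars, in which the
  contributions \<wp>(u) cancel. The dynamical shifts are felt only when two of the three dynamical
  indices coincide. They then turn a difference \<open>x\<close> of parameters into
  \<open>x - h\<close>, \<open>h - x\<close> or \<open>x + h\<close>, which is exactly what makes
  \<open>h\<close> fit the role of one of the arguments \<open>x\<close>, \<open>y\<close>,
  \<open>x + y\<close> in the relations for \<open>R\<close>.\<close>

lemma periodic_shift_has_integral:
  fixes h :: "complex \<Rightarrow> complex"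
  assumes hol: "h holomorphic_on UNIV" and per: "\<And>x. h (x + 1) = h x"
  shows "integral {0..1} (\<lambda>t. h (s + of_real t)) = integral {0..1} (\<lambda>t. h (of_real t))"
proof -
  obtain H where H: "(H has_field_derivative h x) (at x)" for x
    using holomorphic_convex_primitive' [OF convex_UNIV open_UNIV hol] by auto
  have int: "integral {0..1} (\<lambda>t. h (s + of_real t)) = H (s + 1) - H s" for s
  proof (rule integral_unique)
    have "((\<lambda>t. h (s + of_real t)) has_integral H (s + of_real 1) - H (s + of_real 0)) {0..1}"
    proof (rule fundamental_theorem_of_calculus)
      fix t :: real
      have "((\<lambda>t. H (s + t)) has_field_derivative h (s + of_real t)) (at (of_real t))"
        using DERIV_shift [of H "h (s + of_real t)" "of_real t" s] H [of "s + of_real t"]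
        by (simp add: add.commute)
      from has_vector_derivative_real_field [OF this]
      show "((\<lambda>t. H (s + of_real t)) has_vector_derivative h (s + of_real t)) (at t within {0..1})" .
    qed simp
    then show "((\<lambda>t. h (s + of_real t)) has_integral H (s + 1) - H s) {0..1}" by simp
  qed
  \<comment> \<open>The integral over a unit segment is an increment of the primitive
    \<open>H\<close>; periodicity makes this increment independent of the starting point.\<close>
  have "((\<lambda>x. H (x + 1) - H x) has_field_derivative 0) (at x)" for x
  proof -
    have "((\<lambda>x. H (x + 1)) has_field_derivative h (x + 1)) (at x)"
      using DERIV_shift [of H "h (x + 1)" x 1] H by simp
    from DERIV_diff [OF this H] per show ?thesis by simp
  qed
  then have "\<exists>c. \<forall>x\<in>UNIV. H (x + 1) - H x = c"
    by (intro has_field_derivative_zero_constant) auto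
  then have "H (s + 1) - H s = H (0 + 1) - H 0" by (metis UNIV_I)
  with int [of s] int [of 0] show ?thesis by simp
qed

text \<open>The sign makes \<open>fourier_coeff f n\<close> the coefficient of exp(2 pi i n x). The
  argument is complex because coefficients are also computed on lines parallel to the real
  axis.\<close>

definition fourier_exp :: "int \<Rightarrow> complex \<Rightarrow> complex" where
  "fourier_exp n x = exp (- 2 * of_real pi * \<i> * of_int n * x)"

definition fourier_coeff :: "(complex \<Rightarrow> complex) \<Rightarrow> int \<Rightarrow> complex" where
  "fourier_coeff f n = integral {0..1} (\<lambda>t. f (of_real t) * fourier_exp n (of_real t))"

lemma exp_2pi_i_int: "exp (2 * of_real pi * \<i> * of_int n) = 1"
  by (rule exp_eq_1 [THEN iffD2]) auto

lemma fourier_exp_hol [holomorphic_intros]: "fourier_exp n holomorphic_on S"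
  unfolding fourier_exp_def [abs_def] by (intro holomorphic_intros)

lemma fourier_exp_shift: "fourier_exp n (s + x) = fourier_exp n s * fourier_exp n x"
  unfolding fourier_exp_def exp_add [symmetric] by (simp add: algebra_simps)

lemma norm_fourier_exp: "cmod (fourier_exp n x) = exp (2 * pi * of_int n * Im x)"
  by (simp add: fourier_exp_def norm_exp)

lemma fourier_exp_periodic: "fourier_exp n (x + 1) = fourier_exp n x"
proof -
  have "fourier_exp n 1 = 1"
    using exp_2pi_i_int [of "- n"] by (simp add: fourier_exp_def)
  then show ?thesis by (simp add: fourier_exp_shift)
qed

lemma fourier_exp_add: "fourier_exp (m + n) x = fourier_exp m x * fourier_exp n x"
  by (simp add: fourier_exp_def exp_add [symmetric] algebra_simps)

lemma fourier_integrable: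
  assumes "f holomorphic_on UNIV"
  shows "(\<lambda>t. f (s + of_real t) * fourier_exp n (of_real t)) integrable_on {0..1::real}"
proof (rule integrable_continuous_interval)
  have comp: "continuous_on {0..1} (\<lambda>t::real. g (c + of_real t))"
    if "g holomorphic_on UNIV" for g :: "complex \<Rightarrow> complex" and c
    by (rule continuous_on_compose2 [OF holomorphic_on_imp_continuous_on [OF that]])
      (auto intro!: continuous_intros)
  show "continuous_on {0..1} (\<lambda>t::real. f (s + of_real t) * fourier_exp n (of_real t))"
    using continuous_on_mult [OF comp [OF assms, of s] comp [OF fourier_exp_hol, of n 0]] by simp
qed

lemmas fourier_integrable0 = fourier_integrable [of _ 0, simplified]

text \<open>The height of the line of integration is free. A purely imaginary \<open>s\<close>
  yields decay estimates, and \<open>s = \<tau>\<close> turns quasi-periodicity into a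
  recursion.\<close>

lemma fourier_coeff_shift:
  assumes hol: "f holomorphic_on UNIV" and per: "\<And>x. f (x + 1) = f x"
  shows "fourier_coeff f n =
    fourier_exp n s * integral {0..1} (\<lambda>t. f (s + of_real t) * fourier_exp n (of_real t))"
proof -
  have "fourier_coeff f n = integral {0..1} (\<lambda>t. f (s + of_real t) * fourier_exp n (s + of_real t))"
    unfolding fourier_coeff_def
    by (rule periodic_shift_has_integral [symmetric])
      (auto intro!: holomorphic_intros hol simp: per fourier_exp_periodic)
  also have "\<dots> = integral {0..1} (\<lambda>t. fourier_exp n s * (f (s + of_real t) * fourier_exp n (of_real t)))"
    by (simp add: fourier_exp_shift mult_ac)
  finally show ?thesis by simp
qed

lemma fourier_coeff_one: "fourier_coeff (\<lambda>_. 1) n = (if n = 0 then 1 else 0)"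
proof (cases "n = 0")
  case False
  \<comment> \<open>Shifting by half a period of the exponential shows that the coefficient equals
    its own negative.\<close>
  have "fourier_coeff (\<lambda>_. 1) n = fourier_exp n (1 / (2 * of_int n)) * fourier_coeff (\<lambda>_. 1) n"
    using fourier_coeff_shift [of "\<lambda>_. 1" n] by (simp add: fourier_coeff_def)
  also have "fourier_exp n (1 / (2 * of_int n)) = - 1"
    using False exp_pi_i' by (simp add: fourier_exp_def exp_minus)
  finally show ?thesis using False by simp
qed (simp add: fourier_coeff_def fourier_exp_def)

lemma fourier_coeff_lincomb:
  assumes "f holomorphic_on UNIV" "g holomorphic_on UNIV"
  shows "fourier_coeff (\<lambda>x. a * f x + b * g x) n = a * fourier_coeff f n + b * fourier_coeff g n"
proof -
  have "fourier_coeff (\<lambda>x. a * f x + b * g x) n =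
      integral {0..1} (\<lambda>t. a * (f (of_real t) * fourier_exp n (of_real t)) +
        b * (g (of_real t) * fourier_exp n (of_real t)))"
    by (simp add: fourier_coeff_def algebra_simps)
  also have "\<dots> = a * fourier_coeff f n + b * fourier_coeff g n"
    using fourier_integrable0 [OF assms(1), of n] fourier_integrable0 [OF assms(2), of n]
    by (subst integral_add) (auto simp: fourier_coeff_def intro: integrable_on_mult_right)
  finally show ?thesis .
qed

section \<open>Division and cancellation of entire functions, and uniqueness of Fourier
  coefficients\<close>

text \<open>At a zero \<open>w\<close> of \<open>g\<close> the quotient agrees with that of the
  difference quotients \<open>F\<close> and \<open>G\<close>, which are entire, and
  \<open>G w = deriv g w\<close> is nonzero.\<close>

lemma entire_quotient_simple_zeros:
  fixes f g :: "complex \<Rightarrow> complex"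
  assumes f: "f holomorphic_on UNIV" and g: "g holomorphic_on UNIV"
    and simple: "\<And>z. g z = 0 \<Longrightarrow> deriv g z \<noteq> 0" and zeros: "\<And>z. g z = 0 \<Longrightarrow> f z = 0"
  obtains k where "k holomorphic_on UNIV" "\<And>z. f z = k z * g z"
proof
  let ?k = "\<lambda>z. if g z = 0 then deriv f z / deriv g z else f z / g z"
  show "f z = ?k z * g z" for z
    using zeros by simp
  have slope: "(\<lambda>z. if z = w then deriv f w else (f z - f w) / (z - w)) holomorphic_on UNIV"
    if "f holomorphic_on UNIV" for f :: "complex \<Rightarrow> complex" and w
    by (rule pole_lemma_open) (use that in auto)
  show "?k holomorphic_on UNIV"
  proof (rule analytic_imp_holomorphic, unfold analytic_on_def, rule ballI)
    fix w :: complex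
    define F where "F = (\<lambda>z. if z = w then deriv f w else (f z - f w) / (z - w))"
    define G where "G = (\<lambda>z. if z = w then deriv g w else (g z - g w) / (z - w))"
    have hol: "F holomorphic_on UNIV" "G holomorphic_on UNIV"
      unfolding F_def G_def by (rule slope f g)+
    let ?P = "if g w = 0 then G else g"
    have "?P holomorphic_on UNIV" using hol g by auto
    moreover have "?P w \<noteq> 0" using simple by (auto simp: G_def)
    ultimately obtain e where e: "e > 0" "\<And>z. z \<in> ball w e \<Longrightarrow> ?P z \<noteq> 0"
      using continuous_on_avoid [of UNIV ?P w 0] holomorphic_on_imp_continuous_on
      by (metis UNIV_I mem_ball)
    have "?k holomorphic_on ball w e"
    proof (cases "g w = 0")
      case True
      have "(\<lambda>z. F z / G z) holomorphic_on ball w e"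
        using e True hol by (auto intro!: holomorphic_intros intro: holomorphic_on_subset)
      moreover have "F z / G z = ?k z" if "z \<in> ball w e" for z
        using e(2) [OF that] True zeros [OF True] by (auto simp: F_def G_def)
      ultimately show ?thesis by (rule holomorphic_transform) auto
    next
      case False
      have "(\<lambda>z. f z / g z) holomorphic_on ball w e"
        using e False f g by (auto intro!: holomorphic_intros intro: holomorphic_on_subset)
      moreover have "f z / g z = ?k z" if "z \<in> ball w e" for z
        using e(2) [OF that] False by auto
      ultimately show ?thesis by (rule holomorphic_transform) auto
    qed
    with e show "\<exists>e>0. ?k holomorphic_on ball w e" by blast
  qed
qed

text \<open>\<open>f\<close> vanishes on the open set where \<open>g\<close> does not, which
  contains \<open>a\<close>; the identity theorem does the rest.\<close>

lemma entire_mult_eq_0: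
  fixes f g :: "complex \<Rightarrow> complex"
  assumes f: "f holomorphic_on UNIV" and g: "g holomorphic_on UNIV"
    and prod: "\<And>z. f z * g z = 0" and nz: "g a \<noteq> 0"
  shows "f z = 0"
proof (rule analytic_continuation_open [of "{z. g z \<noteq> 0}" UNIV f "\<lambda>_. 0"])
  show "open {z. g z \<noteq> 0}"
    using g by (intro open_Collect_neq) (auto intro: holomorphic_on_imp_continuous_on)
qed (use assms in auto)

text \<open>The values have an arbitrary type, so that predicates are covered: the vanishing of
  theta is periodic although theta is not.\<close>

lemma periodic_int:
  fixes f :: "complex \<Rightarrow> 'a"
  assumes "\<And>x. f (x + a) = f x"
  shows "f (x + of_int n * a) = f x"
proof (induction n rule: int_induct [of _ 0])
  case base then show ?case by simp
next
  case (step1 i) then show ?case using assms [of "x + of_int i * a"] by (simp add: algebra_simps)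
next
  case (step2 i) then show ?case using assms [of "x + of_int i * a - a"] by (simp add: algebra_simps)
qed

text \<open>
  Write \<open>f t - f x = k t * (1 - exp (2\<pi>\<i> (x - t)))\<close>. Since the Fourier coefficients of \<open>f\<close> vanish, those of
  \<open>k\<close>, multiplied by \<open>exp (2\<pi>\<i> n x)\<close>, do not depend on \<open>n\<close> for \<open>n > 0\<close> and for \<open>n \<le> 0\<close>, with a jump of
  \<open>f x\<close> in between. They decay in both directions, so the jump is zero.
\<close>

theorem fourier_coeff_unique:
  assumes hol: "f holomorphic_on UNIV" and per: "\<And>x. f (x + 1) = f x"
    and zero: "\<And>n. fourier_coeff f n = 0"
  shows "f x = 0"
proof -
  define g where "g = (\<lambda>t. 1 - fourier_exp 1 (t - x))"
  have g_alt: "g = (\<lambda>t. 1 - fourier_exp 1 (- x) * fourier_exp 1 t)"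
    using fourier_exp_shift [of 1 "- x"] by (auto simp: g_def)
  have g: "g holomorphic_on UNIV" unfolding g_alt by (intro holomorphic_intros)
  have g_per: "g (t + 1) = g t" for t by (simp add: g_alt fourier_exp_periodic)
  have g_zero: "f t - f x = 0" if "g t = 0" for t
  proof -
    from that have "exp (2 * of_real pi * \<i> * (x - t)) = 1"
      by (simp add: g_def fourier_exp_def algebra_simps)
    then obtain n :: int where "Re (2 * of_real pi * \<i> * (x - t)) = 0"
      "Im (2 * of_real pi * \<i> * (x - t)) = of_int (2 * n) * pi"
      by (auto simp: exp_eq_1)
    then have "x = t + of_int n" by (auto simp: complex_eq_iff)
    then show ?thesis using periodic_int [of f 1 t n] per by simp
  qed
  have g_deriv: "deriv g t \<noteq> 0" if "g t = 0" for t
  proof -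
    have "(g has_field_derivative 2 * of_real pi * \<i> * fourier_exp 1 (t - x)) (at t)"
      unfolding g_def fourier_exp_def by (auto intro!: derivative_eq_intros)
    with that show ?thesis by (auto simp: g_def dest: DERIV_imp_deriv)
  qed
  have fx: "(\<lambda>t. f t - f x) holomorphic_on UNIV" by (intro holomorphic_intros hol)
  obtain k where k: "k holomorphic_on UNIV" and fk: "\<And>t. f t - f x = k t * g t"
    using entire_quotient_simple_zeros [OF fx g g_deriv g_zero] by metis
  have "g (x + 1/2) \<noteq> 0"
    using exp_pi_i' by (simp add: g_def fourier_exp_def exp_minus)
  have k_per: "k (t + 1) = k t" for t
  proof -
    have "k (t + 1) - k t = 0"
    proof (rule entire_mult_eq_0 [of "\<lambda>t. k (t + 1) - k t" g "x + 1/2"])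
      show "(\<lambda>t. k (t + 1) - k t) holomorphic_on UNIV"
        using k by (auto intro!: holomorphic_intros holomorphic_on_compose_gen [of _ _ k UNIV, unfolded o_def])
      show "(k (z + 1) - k z) * g z = 0" for z
        using fk [of z] fk [of "z + 1"] g_per [of z] per [of z] by (simp add: algebra_simps)
    qed fact+
    then show ?thesis by simp
  qed
  have rec: "fourier_coeff k n - fourier_exp (- 1) x * fourier_coeff k (n + 1) =
      (if n = 0 then - f x else 0)" for n
  proof -
    have "(\<lambda>t. 1 * f t + - f x * 1) = (\<lambda>t. 1 * k t + - fourier_exp (- 1) x * (k t * fourier_exp 1 t))"
    proof
      have "fourier_exp 1 (- x) = fourier_exp (- 1) x"
        by (simp add: fourier_exp_def)
      then show "1 * f t + - f x * 1 = 1 * k t + - fourier_exp (- 1) x * (k t * fourier_exp 1 t)" for t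
        using fk [of t] by (simp add: g_alt algebra_simps)
    qed
    then have "fourier_coeff (\<lambda>t. 1 * f t + - f x * 1) n =
        fourier_coeff (\<lambda>t. 1 * k t + - fourier_exp (- 1) x * (k t * fourier_exp 1 t)) n"
      by (rule arg_cong)
    moreover have "fourier_coeff (\<lambda>t. 1 * f t + - f x * 1) n =
        1 * fourier_coeff f n + - f x * fourier_coeff (\<lambda>_. 1) n"
      by (rule fourier_coeff_lincomb) (auto intro: hol)
    moreover have "fourier_coeff (\<lambda>t. 1 * k t + - fourier_exp (- 1) x * (k t * fourier_exp 1 t)) n =
        1 * fourier_coeff k n + - fourier_exp (- 1) x * fourier_coeff (\<lambda>t. k t * fourier_exp 1 t) n"
      by (rule fourier_coeff_lincomb) (intro holomorphic_intros k)+
    moreover have "fourier_coeff (\<lambda>t. k t * fourier_exp 1 t) n = fourier_coeff k (n + 1)"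
      by (simp add: fourier_coeff_def fourier_exp_add mult_ac)
    ultimately have "fourier_coeff k n - fourier_exp (- 1) x * fourier_coeff k (n + 1) =
        - f x * fourier_coeff (\<lambda>_. 1) n"
      using zero [of n] by simp
    then show ?thesis by (simp add: fourier_coeff_one)
  qed
  define b where "b = (\<lambda>n. fourier_coeff k n * fourier_exp (- n) x)"
  have b_rec: "b n - b (n + 1) = (if n = 0 then - f x else 0)" for n
  proof -
    have "b n - b (n + 1) = (fourier_coeff k n - fourier_exp (- 1) x * fourier_coeff k (n + 1)) *
        fourier_exp (- n) x"
      using fourier_exp_add [of "- n" "- 1" x] by (simp add: b_def algebra_simps)
    then show ?thesis by (simp add: rec) (simp add: fourier_exp_def)
  qed
  have bound: "\<exists>M. \<forall>n. cmod (b n) \<le> M * exp (2 * pi * n * y)" for y :: real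
  proof -
    \<comment> \<open>On the line of height \<open>Im x + y\<close> the exponentials at
      \<open>s\<close> and at \<open>x\<close> combine to the modulus exp(2 pi n y), so the rate
      \<open>y\<close> can be chosen at will.\<close>
    define s where "s = \<i> * of_real (Im x + y)"
    have "continuous_on UNIV k"
      using k holomorphic_on_imp_continuous_on by blast
    then have "continuous_on {0..1} (\<lambda>t::real. k (s + of_real t))"
      by (rule continuous_on_compose2) (auto intro!: continuous_intros)
    then have "compact ((\<lambda>t::real. k (s + of_real t)) ` {0..1})"
      by (rule compact_continuous_image) simp
    from compact_imp_bounded [OF this]
    obtain M where M: "\<forall>t\<in>{0..1::real}. cmod (k (s + of_real t)) \<le> M"
      by (auto simp: bounded_iff)
    have "cmod (b n) \<le> M * exp (2 * pi * n * y)" for n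
    proof -
      have "cmod (integral {0..1} (\<lambda>t. k (s + of_real t) * fourier_exp n (of_real t)))
          \<le> integral {0..1} (\<lambda>t::real. M)"
        by (rule integral_norm_bound_integral)
          (use M in \<open>auto intro: fourier_integrable k simp: norm_mult norm_fourier_exp\<close>)
      then have "cmod (fourier_coeff k n) \<le> cmod (fourier_exp n s) * M"
        by (subst fourier_coeff_shift [OF k k_per, of _ s]) (simp add: norm_mult mult_left_mono)
      then have "cmod (b n) \<le> cmod (fourier_exp n s) * M * cmod (fourier_exp (- n) x)"
        unfolding b_def norm_mult by (rule mult_right_mono) simp
      also have "\<dots> = M * exp (2 * pi * n * y)"
        by (simp add: norm_fourier_exp s_def exp_add [symmetric] algebra_simps)
      finally show ?thesis .
    qed
    then show ?thesis by blast
  qed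
  have b_pos: "b 1 = b (1 + int n)" and b_neg: "b 0 = b (- int n)" for n
  proof -
    show "b 1 = b (1 + int n)"
    proof (induction n)
      case (Suc n) then show ?case using b_rec [of "1 + int n"] by (simp add: add_ac)
    qed simp
    show "b 0 = b (- int n)"
    proof (induction n)
      case (Suc n) then show ?case using b_rec [of "- 1 - int n"] by simp
    qed simp
  qed
  have decay: "(\<lambda>n. M * exp (- 2 * pi * real n)) \<longlonglongrightarrow> 0" for M
    by real_asymp
  \<comment> \<open>The rate -1 controls large positive \<open>n\<close>, the rate 1 large negative
    \<open>n\<close>. As \<open>b\<close> is constant for \<open>n > 0\<close> and for
    \<open>n \<le> 0\<close>, both constants are zero.\<close>
  obtain M1 M2 where M: "\<And>n. cmod (b n) \<le> M1 * exp (2 * pi * n * (- 1))"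
    "\<And>n. cmod (b n) \<le> M2 * exp (2 * pi * n * 1)"
    using bound [of "- 1"] bound [of 1] by auto
  have "cmod (b 1) \<le> M1 * exp (- 2 * pi) * exp (- 2 * pi * real n)" for n
    using M(1) [of "1 + int n"] b_pos [of n] by (simp add: exp_add [symmetric] algebra_simps)
  then have "cmod (b 1) \<le> 0"
    by (intro LIMSEQ_le_const [OF decay]) auto
  moreover have "cmod (b 0) \<le> M2 * exp (- 2 * pi * real n)" for n
    using M(2) [of "- int n"] b_neg [of n] by simp
  then have "cmod (b 0) \<le> 0"
    by (intro LIMSEQ_le_const [OF decay]) auto
  ultimately show ?thesis using b_rec [of 0] by simp
qed

section \<open>Sums over the integers and holomorphy of infinite sums\<close>

lemma summable_on_UNIV_int:
  fixes f :: "int \<Rightarrow> real"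
  assumes "(\<lambda>n. f (int n)) summable_on UNIV" "(\<lambda>n. f (- int n)) summable_on UNIV"
  shows "f summable_on UNIV"
proof -
  have "f summable_on (range int \<union> range (\<lambda>n. - int n))"
    using assms by (intro summable_on_union; subst summable_on_reindex) (auto simp: o_def inj_on_def)
  also have "range int \<union> range (\<lambda>n. - int n) = UNIV"
    by (auto, metis int_cases2 rangeI)
  finally show ?thesis .
qed

lemma summable_on_exp_int: "(\<lambda>k::int. exp (- \<bar>real_of_int k\<bar>)) summable_on UNIV"
proof -
  have "summable (\<lambda>n. exp (- 1 :: real) ^ n)"
    by (rule summable_geometric) simp
  then have "(\<lambda>n. exp (- real n)) summable_on UNIV"
    by (intro summable_nonneg_imp_summable_on) (auto simp: exp_of_nat_mult [symmetric])
  then show ?thesis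
    by (intro summable_on_UNIV_int) auto
qed

lemma holomorphic_infsum:
  fixes f :: "'a \<Rightarrow> complex \<Rightarrow> complex"
  assumes hol: "\<And>k. k \<in> X \<Longrightarrow> f k holomorphic_on cball w r"
    and le: "\<And>k z. k \<in> X \<Longrightarrow> z \<in> cball w r \<Longrightarrow> cmod (f k z) \<le> M k"
    and M: "M summable_on X"
  shows "(\<lambda>z. \<Sum>\<^sub>\<infinity>k\<in>X. f k z) holomorphic_on ball w r"
proof (rule holomorphic_uniform_limit)
  show "uniform_limit (cball w r) (\<lambda>F z. \<Sum>k\<in>F. f k z) (\<lambda>z. \<Sum>\<^sub>\<infinity>k\<in>X. f k z) (finite_subsets_at_top X)"
    by (rule Weierstrass_m_test_general [OF le M])
  have "\<forall>\<^sub>F F in finite_subsets_at_top X. finite F \<and> F \<subseteq> X"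
    by (rule eventually_finite_subsets_at_top_weakI) auto
  then show "\<forall>\<^sub>F F in finite_subsets_at_top X. continuous_on (cball w r) (\<lambda>z. \<Sum>k\<in>F. f k z) \<and>
      (\<lambda>z. \<Sum>k\<in>F. f k z) holomorphic_on ball w r"
  proof eventually_elim
    case (elim F)
    then have "(\<lambda>z. \<Sum>k\<in>F. f k z) holomorphic_on cball w r"
      using hol by (intro holomorphic_intros) auto
    then show ?case
      using holomorphic_on_imp_continuous_on holomorphic_on_subset ball_subset_cball by blast
  qed
qed auto

subsection \<open>The theta function\<close>

definition theta_term :: "complex \<Rightarrow> complex \<Rightarrow> int \<Rightarrow> complex" where
  "theta_term \<tau> x k = exp (of_real pi * \<i> * \<tau> * (of_int k + 1/2)^2
          + 2 * of_real pi * \<i> * (x + 1/2) * (of_int k + 1/2))"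

lemma theta_altdef: "theta \<tau> x = (\<Sum>\<^sub>\<infinity>k. theta_term \<tau> x k)"
  by (simp add: theta_def theta_term_def)

lemma norm_theta_term:
  "cmod (theta_term \<tau> x k) =
     exp (- pi * Im \<tau> * (of_int k + 1/2)^2 - 2 * pi * Im x * (of_int k + 1/2))"
  by (simp add: theta_term_def norm_exp power2_eq_square algebra_simps)

text \<open>Completing the square gives - a s^2 + b |s| \<le> b^2 / (4 a). The summand 1 in
  \<open>?b\<close> reserves a factor exp(- |s|), and the 1/2 in \<open>?C\<close> pays for
  replacing \<open>s = k + 1/2\<close> by \<open>k\<close>.\<close>

lemma theta_term_bound:
  assumes "Im \<tau> > 0"
  obtains C where "C \<ge> 0" "\<And>x k. cmod x \<le> r \<Longrightarrow> cmod (theta_term \<tau> x k) \<le> C * exp (- \<bar>of_int k\<bar>)"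
proof
  let ?a = "pi * Im \<tau>" and ?b = "2 * pi * r + 1"
  let ?C = "exp (?b^2 / (4 * ?a) + 1/2)"
  show "?C \<ge> 0" by simp
  fix x k assume x: "cmod x \<le> r"
  define s where "s = real_of_int k + 1/2"
  have a: "?a > 0" using assms by simp
  have "4 * a * (- a * u^2 + b * u) \<le> b^2" for a b u :: real
    using zero_le_power2 [of "2 * a * u - b"] by (simp add: power2_eq_square algebra_simps)
  from this [of ?a "\<bar>s\<bar>" ?b]
have "(- ?a * s^2 + ?b * \<bar>s\<bar>) * (4 * ?a) \<le> ?b^2"
    by (simp only: power2_abs mult.commute)
  then have 1: "- ?a * s^2 + ?b * \<bar>s\<bar> \<le> ?b^2 / (4 * ?a)"
    using a by (subst pos_le_divide_eq) auto
  have "- (2 * pi * Im x * s) \<le> \<bar>2 * pi * Im x * s\<bar>" by linarith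
  also have "\<dots> = 2 * pi * \<bar>Im x\<bar> * \<bar>s\<bar>" by (simp add: abs_mult)
  also have "\<dots> \<le> 2 * pi * r * \<bar>s\<bar>"
    using x abs_Im_le_cmod [of x] by (intro mult_right_mono mult_left_mono) auto
  finally have 2: "- (2 * pi * Im x * s) \<le> 2 * pi * r * \<bar>s\<bar>" .
  have 3: "\<bar>real_of_int k\<bar> \<le> \<bar>s\<bar> + 1/2" unfolding s_def by linarith
  have "- pi * Im \<tau> * s^2 - 2 * pi * Im x * s \<le> ?b^2 / (4 * ?a) + 1/2 - \<bar>real_of_int k\<bar>"
    using 1 2 3 by (simp add: algebra_simps)
  then show "cmod (theta_term \<tau> x k) \<le> ?C * exp (- \<bar>of_int k\<bar>)"
    by (simp add: norm_theta_term s_def exp_add [symmetric])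
qed

lemma theta_uniform_limit:
  assumes "Im \<tau> > 0"
  shows "uniform_limit (cball 0 r) (\<lambda>F x. \<Sum>k\<in>F. theta_term \<tau> x k) (theta \<tau>)
    (finite_subsets_at_top UNIV)"
proof -
  obtain C where C: "\<And>x k. cmod x \<le> r \<Longrightarrow> cmod (theta_term \<tau> x k) \<le> C * exp (- \<bar>of_int k\<bar>)"
    using theta_term_bound [OF assms] by metis
  have "(\<lambda>k::int. C * exp (- \<bar>real_of_int k\<bar>)) summable_on UNIV"
    by (intro summable_on_cmult_right summable_on_exp_int)
  from Weierstrass_m_test_general [where Y = "cball 0 r", OF _ this, of "\<lambda>k x. theta_term \<tau> x k"] C
  show ?thesis by (simp add: theta_altdef [abs_def])
qed

lemma theta_holomorphic:
  assumes "Im \<tau> > 0"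
  shows "theta \<tau> holomorphic_on S"
proof -
  have "theta \<tau> holomorphic_on ball 0 r" for r
  proof -
    obtain C where C: "\<And>x k. cmod x \<le> r \<Longrightarrow> cmod (theta_term \<tau> x k) \<le> C * exp (- \<bar>of_int k\<bar>)"
      using theta_term_bound [OF assms] by metis
    have "(\<lambda>x. \<Sum>\<^sub>\<infinity>k\<in>UNIV. theta_term \<tau> x k) holomorphic_on ball 0 r"
    proof (rule holomorphic_infsum)
      show "(\<lambda>k::int. C * exp (- \<bar>real_of_int k\<bar>)) summable_on UNIV"
        by (intro summable_on_cmult_right summable_on_exp_int)
      show "(\<lambda>x. theta_term \<tau> x k) holomorphic_on cball 0 r" for k
        unfolding theta_term_def by (intro holomorphic_intros)
    qed (simp add: C)
    then show ?thesis by (simp add: theta_altdef [abs_def])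
  qed
  then have "theta \<tau> field_differentiable at x" for x
    by (rule holomorphic_on_imp_differentiable_at [of _ "ball 0 (cmod x + 1)"]) auto
  then show ?thesis
    using field_differentiable_at_within by (auto simp: holomorphic_on_def)
qed

lemma theta_plus_1: "theta \<tau> (x + 1) = - theta \<tau> x"
proof -
  have "theta_term \<tau> (x + 1) k = - theta_term \<tau> x k" for k
  proof -
    have "theta_term \<tau> (x + 1) k = theta_term \<tau> x k * exp (2 * of_real pi * \<i> * of_int k) * exp (\<i> * of_real pi)"
      unfolding theta_term_def exp_add [symmetric] by (rule arg_cong [of _ _ exp]) (simp add: algebra_simps)
    then show ?thesis by (simp only: exp_2pi_i_int exp_pi_i') simp
  qed
  then show ?thesis by (simp add: theta_altdef infsum_uminus)
qed

text \<open>The reflection of the index \<open>k\<close> to \<open>- 1 - k\<close> negates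
  \<open>k + 1/2\<close>; the summand 1/2 added to \<open>x\<close> then produces the sign.\<close>

lemma theta_minus: "theta \<tau> (- x) = - theta \<tau> x"
proof -
  have "theta \<tau> (- x) = (\<Sum>\<^sub>\<infinity>k. theta_term \<tau> (- x) (- 1 - k))"
    unfolding theta_altdef
    by (rule infsum_reindex_bij_witness [of _ "\<lambda>k. - 1 - k" "\<lambda>k. - 1 - k"]) auto
  moreover have "theta_term \<tau> (- x) (- 1 - k) = - theta_term \<tau> x k" for k
  proof -
    have "theta_term \<tau> (- x) (- 1 - k) = theta_term \<tau> x k * exp (2 * of_real pi * \<i> * of_int (- 1 - k)) * exp (\<i> * of_real pi)"
      unfolding theta_term_def exp_add [symmetric]
      by (rule arg_cong [of _ _ exp]) (simp add: algebra_simps power2_eq_square)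
    then show ?thesis by (simp only: exp_2pi_i_int exp_pi_i') simp
  qed
  ultimately have "theta \<tau> (- x) = (\<Sum>\<^sub>\<infinity>k. - theta_term \<tau> x k)" by simp
  then show ?thesis by (simp add: theta_altdef infsum_uminus)
qed

text \<open>The factor of automorphy of theta under translation by \<tau>.\<close>

definition theta_factor :: "complex \<Rightarrow> complex \<Rightarrow> complex" where
  "theta_factor \<tau> x = - exp (- of_real pi * \<i> * \<tau> - 2 * of_real pi * \<i> * x)"

lemma theta_plus_tau: "theta \<tau> (x + \<tau>) = theta_factor \<tau> x * theta \<tau> x"
proof -
  have "theta_term \<tau> (x + \<tau>) k = theta_factor \<tau> x * theta_term \<tau> x (k + 1)" for k
  proof -
    have "theta_term \<tau> (x + \<tau>) k =
        exp (\<i> * of_real pi) * exp (- of_real pi * \<i> * \<tau> - 2 * of_real pi * \<i> * x) *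
        theta_term \<tau> x (k + 1) * exp (2 * of_real pi * \<i> * of_int (- 1))"
      unfolding theta_term_def exp_add [symmetric]
      by (rule arg_cong [of _ _ exp]) (simp add: algebra_simps power2_eq_square)
    then show ?thesis by (simp only: exp_2pi_i_int exp_pi_i' theta_factor_def) simp
  qed
  then have "theta \<tau> (x + \<tau>) = theta_factor \<tau> x * (\<Sum>\<^sub>\<infinity>k. theta_term \<tau> x (k + 1))"
    by (simp add: theta_altdef infsum_cmult_right')
  also have "(\<Sum>\<^sub>\<infinity>k. theta_term \<tau> x (k + 1)) = theta \<tau> x"
    unfolding theta_altdef
    by (rule infsum_reindex_bij_witness [of _ "\<lambda>k. k - 1" "\<lambda>k. k + 1"]) auto
  finally show ?thesis .
qed

lemma theta_factor_nonzero: "theta_factor \<tau> x \<noteq> 0"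
  by (simp add: theta_factor_def)

text \<open>Oddness gives the zero at 0, and both multipliers, -1 and \<open>theta_factor\<close>,
  are nonzero, so the zero is carried to the whole lattice.\<close>

lemma theta_lattice_point: "theta \<tau> (lattice_point \<tau> p) = 0"
proof -
  obtain m n where p: "p = (m, n)" by fastforce
  have 0: "theta \<tau> 0 = 0" using theta_minus [of \<tau> 0] by simp
  have "(theta \<tau> (0 + of_int m * 1) = 0) = (theta \<tau> 0 = 0)"
    using periodic_int [of "\<lambda>x. theta \<tau> x = 0" 1 0 m] by (simp add: theta_plus_1)
  moreover have "(theta \<tau> (of_int m + of_int n * \<tau>) = 0) = (theta \<tau> (of_int m) = 0)"
    using periodic_int [of "\<lambda>x. theta \<tau> x = 0" \<tau> "of_int m" n] by (simp add: theta_plus_tau theta_factor_nonzero)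
  ultimately show ?thesis using 0 by (simp add: p lattice_point_def)
qed

text \<open>The zeroth Fourier coefficient of \<open>exp (- \<i>\<pi>x) \<theta>(x)\<close> is a single exponential.\<close>

lemma theta_not_identically_zero:
  assumes "Im \<tau> > 0"
  obtains a where "theta \<tau> a \<noteq> 0"
proof (rule ccontr)
  assume "\<not> thesis"
  then have zero: "theta \<tau> x = 0" for x using that by blast
  define c where "c k = exp (of_real pi * \<i> * \<tau> * (of_int k + 1/2)^2 + of_real pi * \<i> * (of_int k + 1/2))" for k :: int
  define g where "g k t = c k * fourier_exp (- k) (of_real t)" for k and t :: real
  \<comment> \<open>The factor exp(- i pi x) moves the half-integral frequencies
    \<open>k + 1/2\<close> to the integers.\<close>
  have tt: "theta_term \<tau> x k * exp (- (of_real pi * \<i> * x)) = c k * fourier_exp (- k) x" for x k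
    unfolding theta_term_def c_def fourier_exp_def exp_add [symmetric]
    by (rule arg_cong [of _ _ exp]) (simp add: algebra_simps)
  have "uniform_limit {0..1::real} (\<lambda>F t. \<Sum>k\<in>F. theta_term \<tau> (of_real t) k) (\<lambda>t. theta \<tau> (of_real t))
      (finite_subsets_at_top UNIV)"
    by (rule uniform_limit_compose' [OF theta_uniform_limit [OF assms, of 1]]) auto
  then have "uniform_limit {0..1::real} (\<lambda>F t. (\<Sum>k\<in>F. theta_term \<tau> (of_real t) k) * exp (- (of_real pi * \<i> * of_real t)))
      (\<lambda>t. theta \<tau> (of_real t) * exp (- (of_real pi * \<i> * of_real t))) (finite_subsets_at_top UNIV)"
    by (intro uniform_lim_mult) (auto simp: zero norm_exp intro!: uniform_limit_const boundedI [of _ 1])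
  then have ul: "uniform_limit {0..1::real} (\<lambda>F t. \<Sum>k\<in>F. g k t) (\<lambda>t. 0) (finite_subsets_at_top UNIV)"
    by (simp add: zero sum_distrib_right tt g_def)
  have int: "(g k has_integral (if k = 0 then c 0 else 0)) {0..1}" for k
  proof -
    have "g k integrable_on {0..1}"
      using fourier_integrable0 [of "\<lambda>_. 1" "- k"] unfolding g_def
      by (intro integrable_on_mult_right) simp
    moreover have "integral {0..1} (g k) = (if k = 0 then c 0 else 0)"
      using fourier_coeff_one [of "- k"] by (simp add: fourier_coeff_def g_def [abs_def])
    ultimately show ?thesis by (metis integrable_integral)
  qed
  have cont: "continuous_on {0..1} (\<lambda>t. \<Sum>k\<in>F. g k t)" for F
    unfolding g_def fourier_exp_def by (intro continuous_intros)
  \<comment> \<open>Uniform convergence lets the integrals pass to the limit. The limit function is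
    0, yet every finite partial sum containing the index 0 has integral \<open>c 0\<close>, an
    exponential.\<close>
  obtain I J where I: "\<And>F. ((\<lambda>t. \<Sum>k\<in>F. g k t) has_integral I F) {0..1}"
    and J: "((\<lambda>_. 0 :: complex) has_integral J) {0..1::real}"
    and IJ: "(I \<longlongrightarrow> J) (finite_subsets_at_top UNIV)"
    using uniform_limit_integral [OF ul cont finite_subsets_at_top_neq_bot] by metis
  have "\<forall>\<^sub>F F in finite_subsets_at_top UNIV. I F = c 0"
    unfolding eventually_finite_subsets_at_top
  proof (intro exI conjI allI impI)
    fix F :: "int set" assume F: "finite F \<and> {0} \<subseteq> F \<and> F \<subseteq> UNIV"
    have "((\<lambda>t. \<Sum>k\<in>F. g k t) has_integral (\<Sum>k\<in>F. if k = 0 then c 0 else 0)) {0..1}"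
      by (rule has_integral_sum) (use F int in auto)
    with F I [of F] show "I F = c 0"
      by (auto dest: has_integral_unique)
  qed auto
  with IJ have "((\<lambda>_. c 0) \<longlongrightarrow> J) (finite_subsets_at_top (UNIV :: int set))"
    by (rule Lim_transform_eventually)
  then have "c 0 = J"
    by (simp add: tendsto_const_iff)
  also have "J = 0"
    using J has_integral_0 has_integral_unique by blast
  finally have "c 0 = 0" .
  then show False by (simp add: c_def)
qed

subsection \<open>The Weierstrass function\<close>

text \<open>The imaginary part controls \<open>n\<close>, then the triangle inequality controls
  \<open>m\<close>. Discreteness of the lattice and convergence of the lattice sums both rest on
  this comparison.\<close>

lemma lattice_point_norm:
  assumes "Im \<tau> > 0"
  obtains K where "K > 0" "\<And>m n. \<bar>real_of_int m\<bar> + \<bar>real_of_int n\<bar> \<le> K * cmod (lattice_point \<tau> (m, n))"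
proof
  let ?K = "1 + (cmod \<tau> + 1) / Im \<tau>"
  show "?K > 0" using assms by (simp add: add_pos_nonneg)
  fix m n
  let ?w = "lattice_point \<tau> (m, n)"
  have "\<bar>of_int n * Im \<tau>\<bar> \<le> cmod ?w"
    using abs_Im_le_cmod [of ?w] by (simp add: lattice_point_def)
  then have n: "\<bar>of_int n\<bar> \<le> cmod ?w / Im \<tau>"
    using assms by (simp add: abs_mult pos_le_divide_eq)
  have "\<bar>of_int m\<bar> = cmod (?w - of_int n * \<tau>)" by (simp add: lattice_point_def)
  also have "\<dots> \<le> cmod ?w + \<bar>of_int n\<bar> * cmod \<tau>"
    using norm_triangle_ineq4 [of ?w "of_int n * \<tau>"] by (simp add: norm_mult)
  also have "\<dots> \<le> cmod ?w + (cmod ?w / Im \<tau>) * cmod \<tau>"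
    using n by (intro add_left_mono mult_right_mono) auto
  finally show "\<bar>real_of_int m\<bar> + \<bar>real_of_int n\<bar> \<le> ?K * cmod ?w"
    using n by (simp add: algebra_simps add_divide_distrib)
qed

lemma finite_lattice_ball:
  assumes "Im \<tau> > 0"
  shows "finite {p. cmod (lattice_point \<tau> p) \<le> r}"
proof -
  obtain K where K: "K > 0" "\<And>m n. \<bar>real_of_int m\<bar> + \<bar>real_of_int n\<bar> \<le> K * cmod (lattice_point \<tau> (m, n))"
    using lattice_point_norm [OF assms] by blast
  let ?N = "\<lceil>K * r\<rceil>"
  have "{p. cmod (lattice_point \<tau> p) \<le> r} \<subseteq> {-?N..?N} \<times> {-?N..?N}"
  proof safe
    fix m n assume "cmod (lattice_point \<tau> (m, n)) \<le> r"
    then have "K * cmod (lattice_point \<tau> (m, n)) \<le> K * r" using K(1) by simp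
    with K(2) [of m n] have "\<bar>real_of_int m\<bar> + \<bar>real_of_int n\<bar> \<le> K * r" by linarith
    then have *: "\<bar>real_of_int m\<bar> \<le> of_int ?N" "\<bar>real_of_int n\<bar> \<le> of_int ?N" by linarith+
    then show "m \<in> {-?N..?N}" "n \<in> {-?N..?N}" by auto
  qed
  then show ?thesis by (rule finite_subset) simp
qed

lemma lattice_point_eq_0_iff:
  assumes "Im \<tau> > 0"
  shows "lattice_point \<tau> p = 0 \<longleftrightarrow> p = (0, 0)"
proof
  assume "lattice_point \<tau> p = 0"
  moreover obtain m n where p: "p = (m, n)" by fastforce
  moreover obtain K where "\<bar>real_of_int m\<bar> + \<bar>real_of_int n\<bar> \<le> K * cmod (lattice_point \<tau> (m, n))"
    using lattice_point_norm [OF assms] by metis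
  ultimately show "p = (0, 0)" by auto
qed (simp add: lattice_point_def)

lemma abs_add_abs_ge_1: "(m, n) \<noteq> (0, 0) \<Longrightarrow> \<bar>real_of_int m\<bar> + \<bar>real_of_int n\<bar> \<ge> 1"
proof -
  assume "(m, n) \<noteq> (0, 0)"
  then have "\<bar>m\<bar> + \<bar>n\<bar> \<ge> 1" by auto
  then have "real_of_int (\<bar>m\<bar> + \<bar>n\<bar>) \<ge> 1" by linarith
  then show ?thesis by simp
qed

text \<open>
  For \<open>\<omega> = m + n \<tau>\<close>, a multiple of \<open>|\<omega>|\<^sup>3\<close> dominates \<open>((1 + |m|) (1 + |n|)) powr (3/2)\<close>,
  the inverse of which is a product of summable functions.
\<close>

lemma summable_lattice_cubes:
  assumes "Im \<tau> > 0"
  shows "(\<lambda>p. 1 / cmod (lattice_point \<tau> p) ^ 3) summable_on (UNIV - {(0, 0)})"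
proof -
  obtain K where K: "K > 0" "\<And>m n. \<bar>real_of_int m\<bar> + \<bar>real_of_int n\<bar> \<le> K * cmod (lattice_point \<tau> (m, n))"
    using lattice_point_norm [OF assms] by blast
  define a where "a m = (1 + \<bar>real_of_int m\<bar>) powr (- 3/2)" for m
  have "summable (\<lambda>n. real n powr (- 3/2))" by (simp add: summable_real_powr_iff)
  then have "summable (\<lambda>n. real (Suc n) powr (- 3/2))"
    by (subst summable_Suc_iff)
  then have "(\<lambda>n. real (Suc n) powr (- 3/2)) summable_on UNIV"
    by (intro summable_nonneg_imp_summable_on) auto
  then have a: "a summable_on UNIV"
    by (intro summable_on_UNIV_int) (auto simp: a_def add.commute)
  have "(\<lambda>(m, n). a m * a n) summable_on (UNIV \<times> UNIV)"
  proof (rule summable_on_SigmaI)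
    show "((\<lambda>n. case (m, n) of (m, n) \<Rightarrow> a m * a n) has_sum a m * infsum a UNIV) UNIV" for m
      using has_sum_cmult_right [OF has_sum_infsum [OF a]] by simp
    show "(\<lambda>m. a m * infsum a UNIV) summable_on UNIV"
      by (intro summable_on_cmult_left a)
  qed (auto simp: a_def)
  then have "(\<lambda>p. (2 * K) ^ 3 * (case p of (m, n) \<Rightarrow> a m * a n)) summable_on (UNIV - {(0, 0)})"
    by (intro summable_on_cmult_right) (auto intro: summable_on_subset)
  then show ?thesis
  proof (rule summable_on_comparison_test)
    fix p assume "p \<in> UNIV - {(0 :: int, 0 :: int)}"
    then obtain m n where p: "p = (m, n)" "(m, n) \<noteq> (0, 0)" by (cases p) auto
    let ?w = "cmod (lattice_point \<tau> p)"
    let ?m = "\<bar>real_of_int m\<bar>" and ?n = "\<bar>real_of_int n\<bar>"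
    have "?w > 0" using p lattice_point_eq_0_iff [OF assms] by simp
    have "?m + ?n \<ge> 1" using p(2) by (rule abs_add_abs_ge_1)
    then have "(1 + ?m) * (1 + ?n) \<le> (2 * (?m + ?n)) * (2 * (?m + ?n))"
      by (intro mult_mono) auto
    then have "(1 + ?m) * (1 + ?n) \<le> (2 * (?m + ?n))^2"
      by (simp only: power2_eq_square)
    also have "\<dots> \<le> (2 * K * ?w)^2"
      using K(2) [of m n] p by (intro power_mono) auto
    finally have "((1 + ?m) * (1 + ?n)) powr (3/2) \<le> ((2 * K * ?w)^2) powr (3/2)"
      by (intro powr_mono2) auto
    also have "\<dots> = (2 * K * ?w) ^ 3"
      using K \<open>?w > 0\<close> by (simp add: powr_powr flip: powr_numeral)
    finally have "(1 + ?m) powr (3/2) * (1 + ?n) powr (3/2) \<le> (2 * K)^3 * ?w ^ 3"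
      by (simp add: powr_mult power_mult_distrib)
    then show "1 / ?w ^ 3 \<le> (2 * K) ^ 3 * (case p of (m, n) \<Rightarrow> a m * a n)"
      using \<open>?w > 0\<close> unfolding p a_def by (simp add: powr_minus field_simps)
  qed simp
qed

definition wp_term :: "complex \<Rightarrow> complex \<Rightarrow> int \<times> int \<Rightarrow> complex" where
  "wp_term \<tau> x p = 1 / (x - lattice_point \<tau> p)^2 - 1 / (lattice_point \<tau> p)^2"

lemma wp_altdef: "weierstrass_p (Elliptic \<tau>) x = 1 / x^2 + (\<Sum>\<^sub>\<infinity>p\<in>UNIV - {(0, 0)}. wp_term \<tau> x p)"
  by (simp add: wp_term_def)

text \<open>With w the lattice point, the term is x (2 w - x) / ((x - w)^2 w^2). Since |x| \<le> |w|
  / 2, the numerator is at most r * (5/2) |w| and |x - w| is at least |w| / 2, whence 10 = 4 *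
  5/2.\<close>

lemma norm_wp_term_le:
  assumes "cmod x \<le> r" "2 * r \<le> cmod (lattice_point \<tau> p)" "lattice_point \<tau> p \<noteq> 0"
  shows "cmod (wp_term \<tau> x p) \<le> 10 * r * (1 / cmod (lattice_point \<tau> p) ^ 3)"
proof -
  let ?w = "lattice_point \<tau> p"
  have w: "cmod ?w > 0" using assms by simp
  have 1: "cmod ?w / 2 \<le> cmod (x - ?w)"
    using norm_triangle_ineq2 [of ?w x] assms by (simp add: norm_minus_commute)
  then have nz: "x - ?w \<noteq> 0" using w by auto
  have 2: "cmod (2 * ?w - x) \<le> 5/2 * cmod ?w"
    using norm_triangle_ineq4 [of "2 * ?w" x] assms by (simp add: norm_mult)
  have "wp_term \<tau> x p = x * (2 * ?w - x) / ((x - ?w)^2 * ?w^2)"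
    using nz assms by (simp add: wp_term_def divide_simps) (simp add: power2_eq_square algebra_simps)
  then have "cmod (wp_term \<tau> x p) = cmod x * cmod (2 * ?w - x) / (cmod (x - ?w)^2 * cmod ?w^2)"
    by (simp add: norm_mult norm_divide norm_power)
  also have "\<dots> \<le> r * (5/2 * cmod ?w) / ((cmod ?w / 2)^2 * cmod ?w^2)"
    using 1 2 w assms
    by (intro frac_le mult_mono power_mono mult_pos_pos mult_nonneg_nonneg) (auto intro: order_trans [OF norm_ge_zero])
  also have "\<dots> = 10 * r * (1 / cmod ?w ^ 3)"
    using w by (simp add: field_simps power2_eq_square power3_eq_cube)
  finally show ?thesis .
qed

lemma wp_term_summable:
  assumes "Im \<tau> > 0" "A \<subseteq> UNIV - {(0, 0)}" "\<And>p. p \<in> A \<Longrightarrow> 2 * r \<le> cmod (lattice_point \<tau> p)" "cmod x \<le> r"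
  shows "wp_term \<tau> x summable_on A"
proof (rule Infinite_Sum.abs_summable_summable, rule Infinite_Sum.abs_summable_on_comparison_test')
  show "(\<lambda>p. 10 * r * (1 / cmod (lattice_point \<tau> p) ^ 3)) summable_on A"
    by (intro summable_on_cmult_right summable_on_subset [OF summable_lattice_cubes]) (use assms in auto)
  fix p assume "p \<in> A"
  then show "norm (wp_term \<tau> x p) \<le> 10 * r * (1 / cmod (lattice_point \<tau> p) ^ 3)"
    by (intro norm_wp_term_le) (use assms lattice_point_eq_0_iff in auto)
qed

text \<open>The terms with small lattice points are finitely many. Lattice points \<open>x\<close>
  are included: the singular summand there is 1/0 = 0 and lies in the finite part.\<close>

lemma summable_wp_term:
  assumes \<tau>: "Im \<tau> > 0"
  shows "wp_term \<tau> x summable_on (UNIV - {(0, 0)})"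
proof -
  let ?S = "\<lambda>P. {p. p \<noteq> (0, 0) \<and> P (cmod (lattice_point \<tau> p))}"
  let ?r = "2 * cmod x"
  have "finite (?S (\<lambda>t. t < ?r))"
    by (rule finite_subset [OF _ finite_lattice_ball [OF \<tau>, of ?r]]) auto
  then have "wp_term \<tau> x summable_on ?S (\<lambda>t. t < ?r)"
    by (rule summable_on_finite)
  moreover have "wp_term \<tau> x summable_on ?S (\<lambda>t. ?r \<le> t)"
    by (rule wp_term_summable [OF \<tau>, of _ "cmod x"]) auto
  ultimately have "wp_term \<tau> x summable_on (?S (\<lambda>t. t < ?r) \<union> ?S (\<lambda>t. ?r \<le> t))"
    by (rule summable_on_Un_disjoint) auto
  also have "?S (\<lambda>t. t < ?r) \<union> ?S (\<lambda>t. ?r \<le> t) = UNIV - {(0, 0)}"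
    by auto
  finally show ?thesis .
qed

text \<open>Only lattice points of modulus below \<open>2 * r\<close> can cause poles in the ball;
  the remaining terms are dominated by a convergent series. Holomorphy off the lattice and the shape
  of the pole at 0 are both read off from this decomposition.\<close>

lemma wp_local:
  assumes \<tau>: "Im \<tau> > 0"
  shows "\<exists>h. h holomorphic_on ball 0 r \<and> (\<forall>x\<in>ball 0 r. weierstrass_p (Elliptic \<tau>) x =
      1 / x^2 + (\<Sum>p\<in>{p. p \<noteq> (0, 0) \<and> cmod (lattice_point \<tau> p) < 2 * r}. wp_term \<tau> x p) + h x)"
proof (intro exI conjI ballI)
  define F where "F = {p. p \<noteq> (0, 0) \<and> cmod (lattice_point \<tau> p) < 2 * r}"
  define A where "A = {p. p \<noteq> (0, 0) \<and> 2 * r \<le> cmod (lattice_point \<tau> p)}"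
  have F: "finite F"
    by (rule finite_subset [OF _ finite_lattice_ball [OF \<tau>, of "2 * r"]]) (auto simp: F_def)
  have FA: "UNIV - {(0, 0)} = F \<union> A" "F \<inter> A = {}" by (auto simp: F_def A_def)
  show "(\<lambda>x. \<Sum>\<^sub>\<infinity>p\<in>A. wp_term \<tau> x p) holomorphic_on ball 0 r"
  proof (rule holomorphic_infsum)
    show "(\<lambda>p. 10 * r * (1 / cmod (lattice_point \<tau> p) ^ 3)) summable_on A"
      by (intro summable_on_cmult_right summable_on_subset [OF summable_lattice_cubes [OF \<tau>]]) (auto simp: A_def)
    fix p assume "p \<in> A"
    then have p: "lattice_point \<tau> p \<noteq> 0" "2 * r \<le> cmod (lattice_point \<tau> p)"
      using lattice_point_eq_0_iff [OF \<tau>] by (auto simp: A_def)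
    show "cmod (wp_term \<tau> z p) \<le> 10 * r * (1 / cmod (lattice_point \<tau> p) ^ 3)" if "z \<in> cball 0 r" for z
      using p that by (intro norm_wp_term_le) auto
    have "z - lattice_point \<tau> p \<noteq> 0" if "z \<in> cball 0 r" for z
    proof
      assume "z - lattice_point \<tau> p = 0"
      with that have "cmod (lattice_point \<tau> p) \<le> r" by simp
      with p(2) have "cmod (lattice_point \<tau> p) \<le> 0" by linarith
      with p(1) show False by simp
    qed
    then show "(\<lambda>z. wp_term \<tau> z p) holomorphic_on cball 0 r"
      using p unfolding wp_term_def by (intro holomorphic_intros) auto
  qed
  fix x :: complex assume x: "x \<in> ball 0 r"
  have A: "wp_term \<tau> x summable_on A"
    by (rule wp_term_summable [OF \<tau>, of _ r]) (use x in \<open>auto simp: A_def\<close>)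
  have "(\<Sum>\<^sub>\<infinity>p\<in>F \<union> A. wp_term \<tau> x p) = (\<Sum>p\<in>F. wp_term \<tau> x p) + (\<Sum>\<^sub>\<infinity>p\<in>A. wp_term \<tau> x p)"
    using F A FA by (subst infsum_Un_disjoint) auto
  then show "weierstrass_p (Elliptic \<tau>) x =
      1 / x^2 + (\<Sum>p\<in>{p. p \<noteq> (0, 0) \<and> cmod (lattice_point \<tau> p) < 2 * r}. wp_term \<tau> x p) +
      (\<Sum>\<^sub>\<infinity>p\<in>A. wp_term \<tau> x p)"
    unfolding wp_altdef FA F_def [symmetric] by simp
qed

lemma lattice_not_islimpt:
  assumes "Im \<tau> > 0"
  shows "\<not> x islimpt range (lattice_point \<tau>)"
proof
  assume "x islimpt range (lattice_point \<tau>)"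
  then have "infinite (range (lattice_point \<tau>) \<inter> ball x 1)"
    by (simp add: islimpt_eq_infinite_ball)
  moreover have "range (lattice_point \<tau>) \<inter> ball x 1 \<subseteq> lattice_point \<tau> ` {p. cmod (lattice_point \<tau> p) \<le> cmod x + 1}"
  proof safe
    fix p assume "lattice_point \<tau> p \<in> ball x 1"
    then have "cmod (lattice_point \<tau> p) \<le> cmod x + 1"
      using norm_triangle_ineq2 [of "lattice_point \<tau> p" x] by (simp add: dist_norm norm_minus_commute)
    then show "lattice_point \<tau> p \<in> lattice_point \<tau> ` {p. cmod (lattice_point \<tau> p) \<le> cmod x + 1}"
      by blast
  qed
  ultimately show False
    using finite_lattice_ball [OF assms] finite_subset by blast
qed

lemma closed_lattice: "Im \<tau> > 0 \<Longrightarrow> closed (range (lattice_point \<tau>))"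
  using lattice_not_islimpt closed_limpt by blast

lemma wp_holomorphic:
  assumes \<tau>: "Im \<tau> > 0"
  shows "weierstrass_p (Elliptic \<tau>) holomorphic_on (- range (lattice_point \<tau>))"
proof -
  have "weierstrass_p (Elliptic \<tau>) field_differentiable at x" if x: "x \<notin> range (lattice_point \<tau>)" for x
  proof -
    define r where "r = cmod x + 1"
    obtain h where h: "h holomorphic_on ball 0 r" "\<forall>x\<in>ball 0 r. weierstrass_p (Elliptic \<tau>) x =
      1 / x^2 + (\<Sum>p\<in>{p. p \<noteq> (0, 0) \<and> cmod (lattice_point \<tau> p) < 2 * r}. wp_term \<tau> x p) + h x"
      using wp_local [OF \<tau>, of r] by blast
    let ?U = "ball 0 r - range (lattice_point \<tau>)"
    have nz: "z - lattice_point \<tau> p \<noteq> 0" if "z \<in> ?U" for z p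
      using that by auto
    have nz0: "z \<noteq> 0" if "z \<in> ?U" for z
      using nz [OF that, of "(0, 0)"] by (simp add: lattice_point_def)
    have "(\<lambda>x. 1 / x^2 + (\<Sum>p\<in>{p. p \<noteq> (0, 0) \<and> cmod (lattice_point \<tau> p) < 2 * r}. wp_term \<tau> x p) + h x)
        holomorphic_on ?U"
      unfolding wp_term_def using nz nz0 lattice_point_eq_0_iff [OF \<tau>]
      by (intro holomorphic_intros holomorphic_on_subset [OF h(1)]) auto
    then have "weierstrass_p (Elliptic \<tau>) holomorphic_on ?U"
      by (rule holomorphic_transform) (use h(2) in \<open>auto simp del: weierstrass_p.simps\<close>)
    then show ?thesis
      by (rule holomorphic_on_imp_differentiable_at) (use x closed_lattice [OF \<tau>] in \<open>auto simp: r_def\<close>)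
  qed
  then show ?thesis
    using field_differentiable_at_within by (auto simp: holomorphic_on_def)
qed

lemma wp_pole_at_0:
  assumes \<tau>: "Im \<tau> > 0"
  shows "\<exists>h r. r > 0 \<and> h holomorphic_on ball 0 r \<and>
    (\<forall>x\<in>ball 0 r. weierstrass_p (Elliptic \<tau>) x = 1 / x^2 + h x) \<and>
    (\<forall>x\<in>ball 0 r. x \<noteq> 0 \<longrightarrow> x \<notin> range (lattice_point \<tau>))"
proof -
  obtain K where K: "K > 0" "\<And>m n. \<bar>real_of_int m\<bar> + \<bar>real_of_int n\<bar> \<le> K * cmod (lattice_point \<tau> (m, n))"
    using lattice_point_norm [OF assms] by blast
  \<comment> \<open>A nonzero lattice point has modulus at least \<open>1 / K = 2 * r\<close>, so
    the finite sum in \<open>wp_local\<close> is empty.\<close>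
  define r where "r = 1 / (2 * K)"
  have far: "2 * r \<le> cmod (lattice_point \<tau> p)" if "p \<noteq> (0, 0)" for p
  proof -
    obtain m n where p: "p = (m, n)" by fastforce
    have "1 \<le> K * cmod (lattice_point \<tau> p)"
      using K(2) [of m n] abs_add_abs_ge_1 [of m n] that by (simp add: p)
    then show ?thesis using K(1) by (simp add: r_def field_simps)
  qed
  have empty: "{p. p \<noteq> (0, 0) \<and> cmod (lattice_point \<tau> p) < 2 * r} = {}"
    using far by (auto simp: not_less [symmetric])
  have "r > 0" using K by (simp add: r_def)
  obtain h where h: "h holomorphic_on ball 0 r" "\<forall>x\<in>ball 0 r. weierstrass_p (Elliptic \<tau>) x = 1 / x^2 + h x"
    using wp_local [OF \<tau>, of r, unfolded empty sum.empty add_0_right] by blast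
  have "\<forall>x\<in>ball 0 r. x \<noteq> 0 \<longrightarrow> x \<notin> range (lattice_point \<tau>)"
  proof (intro ballI impI)
    fix x :: complex assume x: "x \<in> ball 0 r" "x \<noteq> 0"
    have "x \<noteq> lattice_point \<tau> p" for p
      using far [of p] x \<open>r > 0\<close> lattice_point_eq_0_iff [OF \<tau>, of p] by force
    then show "x \<notin> range (lattice_point \<tau>)" by blast
  qed
  with \<open>r > 0\<close> h show ?thesis by blast
qed

text \<open>In a difference the compensating terms cancel and 1/x^2 - 1/y^2 supplies the missing
  index, so the sum runs over the whole lattice and can be translated.\<close>

lemma wp_diff:
  assumes \<tau>: "Im \<tau> > 0"
  shows "weierstrass_p (Elliptic \<tau>) x - weierstrass_p (Elliptic \<tau>) y =
    (\<Sum>\<^sub>\<infinity>p. 1 / (x - lattice_point \<tau> p)^2 - 1 / (y - lattice_point \<tau> p)^2)"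
proof -
  let ?f = "\<lambda>p. 1 / (x - lattice_point \<tau> p)^2 - 1 / (y - lattice_point \<tau> p)^2"
  have f: "?f p = wp_term \<tau> x p + - wp_term \<tau> y p" for p by (simp add: wp_term_def)
  have sum: "(\<lambda>p. - wp_term \<tau> y p) summable_on (UNIV - {(0, 0)})"
    using summable_wp_term [OF \<tau>] by (simp add: summable_on_uminus)
  have "?f summable_on (UNIV - {(0, 0)})"
    unfolding f by (intro summable_on_add summable_wp_term \<tau> sum)
  then have "(\<Sum>\<^sub>\<infinity>p\<in>insert (0, 0) (UNIV - {(0, 0)}). ?f p) = ?f (0, 0) + (\<Sum>\<^sub>\<infinity>p\<in>UNIV - {(0, 0)}. ?f p)"
    by (rule infsum_insert) auto
  also have "(\<Sum>\<^sub>\<infinity>p\<in>UNIV - {(0, 0)}. ?f p) =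
      (\<Sum>\<^sub>\<infinity>p\<in>UNIV - {(0, 0)}. wp_term \<tau> x p) + (\<Sum>\<^sub>\<infinity>p\<in>UNIV - {(0, 0)}. - wp_term \<tau> y p)"
    unfolding f by (intro infsum_add summable_wp_term \<tau> sum)
  finally show ?thesis
    unfolding wp_altdef by (simp add: infsum_uminus insert_UNIV insert_absorb lattice_point_def)
qed

lemma wp_minus: "weierstrass_p (Elliptic \<tau>) (- x) = weierstrass_p (Elliptic \<tau>) x"
proof -
  have "(\<Sum>\<^sub>\<infinity>p\<in>UNIV - {(0, 0)}. wp_term \<tau> (- x) p) = (\<Sum>\<^sub>\<infinity>p\<in>UNIV - {(0, 0)}. wp_term \<tau> x p)"
  proof (rule infsum_reindex_bij_witness [of _ uminus uminus])
    fix p assume "p \<in> UNIV - {(0 :: int, 0 :: int)}"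
    have "lattice_point \<tau> (- p) = - lattice_point \<tau> p" by (simp add: lattice_point_def split_beta)
    moreover have "(- x - lattice_point \<tau> p)^2 = (x + lattice_point \<tau> p)^2"
      by (simp add: power2_eq_square algebra_simps)
    ultimately show "wp_term \<tau> x (- p) = wp_term \<tau> (- x) p" by (simp add: wp_term_def)
  qed (auto simp: zero_prod_def [symmetric])
  then show ?thesis by (simp only: wp_altdef power2_minus)
qed

lemma wp_shift_diff:
  assumes \<tau>: "Im \<tau> > 0"
  shows "weierstrass_p (Elliptic \<tau>) (x + lattice_point \<tau> p0) - weierstrass_p (Elliptic \<tau>) (y + lattice_point \<tau> p0) =
    weierstrass_p (Elliptic \<tau>) x - weierstrass_p (Elliptic \<tau>) y"
  unfolding wp_diff [OF \<tau>]
proof (rule infsum_reindex_bij_witness [of _ "\<lambda>p. p + p0" "\<lambda>p. p - p0"])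
  fix p
  have "x - lattice_point \<tau> (p - p0) = x + lattice_point \<tau> p0 - lattice_point \<tau> p" for x
    by (simp add: lattice_point_def split_beta algebra_simps)
  then show "1 / (x - lattice_point \<tau> (p - p0))^2 - 1 / (y - lattice_point \<tau> (p - p0))^2 =
      1 / (x + lattice_point \<tau> p0 - lattice_point \<tau> p)^2 - 1 / (y + lattice_point \<tau> p0 - lattice_point \<tau> p)^2"
    by (simp only:)
qed auto

text \<open>Translation by a lattice point w changes \<wp> by a constant; comparing the values at
  -w/2 and w/2, which agree by evenness, shows that it is 0. If w/2 is itself a lattice point, the
  convention 1/0 = 0 keeps the argument valid.\<close>

lemma wp_periodic:
  assumes \<tau>: "Im \<tau> > 0"
  shows "weierstrass_p (Elliptic \<tau>) (x + lattice_point \<tau> p) = weierstrass_p (Elliptic \<tau>) x"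
proof -
  let ?w = "lattice_point \<tau> p"
  from wp_shift_diff [OF \<tau>, of x p "- (?w / 2)"]
  show ?thesis using wp_minus [of \<tau> "?w / 2"] by (simp del: weierstrass_p.simps)
qed

subsection \<open>Theta functions of second order\<close>

text \<open>The multipliers are the squares of those of theta: these are the sections of a line
  bundle of degree two on the torus.\<close>

definition theta2_space :: "complex \<Rightarrow> (complex \<Rightarrow> complex) set" where
  "theta2_space \<tau> = {f. f holomorphic_on UNIV \<and> (\<forall>x. f (x + 1) = f x) \<and>
     (\<forall>x. f (x + \<tau>) = theta_factor \<tau> x ^ 2 * f x)}"

lemma theta2_space_lincomb:
  assumes "f \<in> theta2_space \<tau>" "g \<in> theta2_space \<tau>"
  shows "(\<lambda>x. a * f x + b * g x) \<in> theta2_space \<tau>"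
  using assms by (auto simp: theta2_space_def algebra_simps intro!: holomorphic_intros)

text \<open>The squared multiplier contains \<open>fourier_exp 2 x\<close>, which raises the
  frequency by 2 when the line of integration is moved by \<tau>. Hence the coefficients 0 and 1
  determine all others.\<close>

lemma theta2_space_coeff_rec:
  assumes f: "f \<in> theta2_space \<tau>"
  shows "fourier_coeff f n = fourier_exp (n + 1) \<tau> * fourier_coeff f (n + 2)"
proof -
  have hol: "f holomorphic_on UNIV" and per: "f (x + 1) = f x"
    and quasi: "f (x + \<tau>) = theta_factor \<tau> x ^ 2 * f x" for x
    using f by (auto simp: theta2_space_def)
  have factor: "theta_factor \<tau> x ^ 2 = fourier_exp 1 \<tau> * fourier_exp 2 x" for x
    by (simp add: theta_factor_def fourier_exp_def power2_eq_square exp_add [symmetric] algebra_simps)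
  have "fourier_coeff f n = fourier_exp n \<tau> * integral {0..1} (\<lambda>t. f (\<tau> + of_real t) * fourier_exp n (of_real t))"
    by (rule fourier_coeff_shift [OF hol per])
  also have "(\<lambda>t. f (\<tau> + of_real t) * fourier_exp n (of_real t)) =
      (\<lambda>t. fourier_exp 1 \<tau> * (f (of_real t) * fourier_exp (n + 2) (of_real t)))"
    using quasi by (simp add: add.commute [of \<tau>] factor fourier_exp_add mult_ac)
  finally show ?thesis by (simp add: fourier_coeff_def fourier_exp_add)
qed

lemma theta2_space_determined:
  assumes f: "f \<in> theta2_space \<tau>" and zero: "fourier_coeff f 0 = 0" "fourier_coeff f 1 = 0"
  shows "f x = 0"
proof -
  have "fourier_coeff f n = 0 \<and> fourier_coeff f (n + 1) = 0" for n
  proof (induction n rule: int_induct [of _ 0])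
    case (step1 i)
    have "fourier_exp (i + 1) \<tau> \<noteq> 0" by (simp add: fourier_exp_def)
    with step1 theta2_space_coeff_rec [OF f, of i] show ?case by (simp add: add_ac)
  next
    case (step2 i)
    with theta2_space_coeff_rec [OF f, of "i - 1"] show ?case by (simp add: add.commute)
  qed (use zero in simp)
  then show ?thesis
    using f by (intro fourier_coeff_unique [of f]) (auto simp: theta2_space_def)
qed

lemma holomorphic_theta_compose [holomorphic_intros]:
  assumes "Im \<tau> > 0" "g holomorphic_on S"
  shows "(\<lambda>x. theta \<tau> (g x)) holomorphic_on S"
  using holomorphic_on_compose_gen [OF assms(2) theta_holomorphic [OF assms(1), of UNIV]]
  by (simp add: o_def)

lemma theta_product_in_theta2_space:
  assumes "Im \<tau> > 0"
  shows "(\<lambda>x. theta \<tau> (x + a) * theta \<tau> (x - a)) \<in> theta2_space \<tau>"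
proof -
  have "theta \<tau> (x + 1 + a) * theta \<tau> (x + 1 - a) = theta \<tau> (x + a) * theta \<tau> (x - a)" for x
    using theta_plus_1 [of \<tau> "x + a"] theta_plus_1 [of \<tau> "x - a"] by (simp add: algebra_simps)
  moreover have "theta \<tau> (x + \<tau> + a) * theta \<tau> (x + \<tau> - a) =
      theta_factor \<tau> x ^ 2 * (theta \<tau> (x + a) * theta \<tau> (x - a))" for x
  proof -
    have "theta_factor \<tau> (x + a) * theta_factor \<tau> (x - a) = theta_factor \<tau> x ^ 2"
      by (simp add: theta_factor_def power2_eq_square exp_add [symmetric] algebra_simps)
    then show ?thesis
      using theta_plus_tau [of \<tau> "x + a"] theta_plus_tau [of \<tau> "x - a"] by (simp add: algebra_simps)
  qed
  ultimately show ?thesis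
    using assms by (auto simp: theta2_space_def intro!: holomorphic_intros)
qed

text \<open>As functions of \<open>a\<close> both factors are entire and not identically zero, so
  their product cannot vanish identically.\<close>

lemma theta_product_nonzero:
  assumes \<tau>: "Im \<tau> > 0"
  obtains a where "theta \<tau> (y + a) * theta \<tau> (y - a) \<noteq> 0"
proof (rule ccontr)
  assume "\<not> thesis"
  then have prod: "theta \<tau> (y + a) * theta \<tau> (y - a) = 0" for a using that by blast
  obtain c where c: "theta \<tau> c \<noteq> 0" using theta_not_identically_zero [OF \<tau>] .
  have "theta \<tau> (y + (c - y)) = 0"
    by (rule entire_mult_eq_0 [of "\<lambda>a. theta \<tau> (y + a)" "\<lambda>a. theta \<tau> (y - a)" "y - c"])
      (use \<tau> c prod in \<open>auto intro!: holomorphic_intros\<close>)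
  with c show False by simp
qed

text \<open>The double poles of the Weierstrass function cancel against the zeros of \<open>theta \<tau> x ^ 2\<close>.\<close>

lemma wp_theta_in_theta2_space:
  assumes \<tau>: "Im \<tau> > 0"
  obtains G where "G \<in> theta2_space \<tau>"
    "\<And>x. x \<notin> range (lattice_point \<tau>) \<Longrightarrow> G x = weierstrass_p (Elliptic \<tau>) x * theta \<tau> x ^ 2"
    "G 0 = deriv (theta \<tau>) 0 ^ 2"
proof
  let ?L = "range (lattice_point \<tau>)"
  define wp where "wp = weierstrass_p (Elliptic \<tau>)"
  \<comment> \<open>At a lattice point w the limit of theta(x)^2 / (x - w)^2 is the square of the
    derivative of theta.\<close>
  define G where "G = (\<lambda>x. if x \<in> ?L then deriv (theta \<tau>) x ^ 2 else wp x * theta \<tau> x ^ 2)"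
  show off: "G x = weierstrass_p (Elliptic \<tau>) x * theta \<tau> x ^ 2" if "x \<notin> ?L" for x
    using that by (simp add: G_def wp_def del: weierstrass_p.simps)
  have "lattice_point \<tau> (0, 0) = 0" by (simp add: lattice_point_def)
  then have "0 \<in> ?L" by (metis rangeI)
  then show "G 0 = deriv (theta \<tau>) 0 ^ 2"
    by (simp add: G_def)
  have shift: "x + lattice_point \<tau> q \<in> ?L \<longleftrightarrow> x \<in> ?L" for x q
  proof
    assume "x \<in> ?L"
    then obtain p where "x = lattice_point \<tau> p" by blast
    then have "x + lattice_point \<tau> q = lattice_point \<tau> (p + q)"
      by (simp add: lattice_point_def split_beta algebra_simps)
    then show "x + lattice_point \<tau> q \<in> ?L" by simp
  next
    assume "x + lattice_point \<tau> q \<in> ?L"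
    then obtain p where "x + lattice_point \<tau> q = lattice_point \<tau> p" by blast
    then have "x = lattice_point \<tau> p - lattice_point \<tau> q"
      by (simp add: eq_diff_eq)
    then have "x = lattice_point \<tau> (p - q)"
      by (simp add: lattice_point_def split_beta algebra_simps)
    then show "x \<in> ?L" by simp
  qed
  obtain h r where r: "r > 0" and h: "h holomorphic_on ball 0 r"
    and wp_h: "\<forall>x\<in>ball 0 r. weierstrass_p (Elliptic \<tau>) x = 1 / x^2 + h x"
    and isolated: "\<forall>x\<in>ball 0 r. x \<noteq> 0 \<longrightarrow> x \<notin> ?L"
    using wp_pole_at_0 [OF \<tau>] by blast
  have hol: "G holomorphic_on UNIV"
  proof (rule analytic_imp_holomorphic, unfold analytic_on_def, rule ballI)
    fix w :: complex
    show "\<exists>e>0. G holomorphic_on ball w e"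
    proof (cases "w \<in> ?L")
      case False
      then obtain e where e: "e > 0" "ball w e \<subseteq> - ?L"
        using closed_lattice [OF \<tau>] open_contains_ball by (metis Compl_iff open_Compl)
      have "(\<lambda>x. wp x * theta \<tau> x ^ 2) holomorphic_on ball w e"
        unfolding wp_def
        by (intro holomorphic_intros \<tau> holomorphic_on_subset [OF wp_holomorphic [OF \<tau>] e(2)])
      then have "G holomorphic_on ball w e"
        by (rule holomorphic_transform) (use e in \<open>auto simp: G_def\<close>)
      with e show ?thesis by blast
    next
      case True
      then obtain p where p: "w = lattice_point \<tau> p" by blast
      have zero: "theta \<tau> w = 0" using theta_lattice_point p by simp
      define F where "F = (\<lambda>z. if z = w then deriv (theta \<tau>) w else (theta \<tau> z - theta \<tau> w) / (z - w))"
      have F: "F holomorphic_on UNIV"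
        unfolding F_def by (rule pole_lemma_open) (use \<tau> theta_holomorphic in auto)
      have h': "(\<lambda>x. h (x - w)) holomorphic_on ball w r"
        by (rule holomorphic_on_compose_gen [of _ _ h "ball 0 r", unfolded o_def])
          (auto intro!: holomorphic_intros h simp: dist_norm norm_minus_commute)
      \<comment> \<open>Near \<open>w\<close>, theta is \<open>(x - w) * F x\<close>, and by
        periodicity \<wp> is the pole 1/(x - w)^2 plus \<open>h (x - w)\<close>.\<close>
      have "(\<lambda>x. F x ^ 2 + h (x - w) * theta \<tau> x ^ 2) holomorphic_on ball w r"
        by (intro holomorphic_intros \<tau> h' holomorphic_on_subset [OF F]) auto
      moreover have "F x ^ 2 + h (x - w) * theta \<tau> x ^ 2 = G x" if x: "x \<in> ball w r" for x
      proof (cases "x = w")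
        case True
        with \<open>w \<in> ?L\<close> show ?thesis by (simp add: G_def F_def zero)
      next
        case False
        have "x - w \<in> ball 0 r" "x - w \<noteq> 0"
          using x False by (auto simp: dist_norm norm_minus_commute)
        then have "x - w \<notin> ?L" and wp: "wp (x - w) = 1 / (x - w)^2 + h (x - w)"
          using isolated wp_h by (auto simp: wp_def simp del: weierstrass_p.simps)
        then have "x \<notin> ?L" using shift [of "x - w" p] p by simp
        moreover have "wp x = wp (x - w)"
          using wp_periodic [OF \<tau>, of "x - w" p] p by (simp add: wp_def del: weierstrass_p.simps)
        ultimately show ?thesis
          using False by (simp add: G_def F_def zero wp power_divide algebra_simps)
      qed
      ultimately have "G holomorphic_on ball w r"
        by (rule holomorphic_transform)
      with r show ?thesis by blast
    qed
  qed
  have G_shift: "(\<lambda>x. G (x + c)) holomorphic_on UNIV" for c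
    by (rule holomorphic_on_compose_gen [of _ _ G UNIV, unfolded o_def]) (auto intro!: holomorphic_intros hol)
  obtain a where a: "theta \<tau> a \<noteq> 0" using theta_not_identically_zero [OF \<tau>] .
  \<comment> \<open>Off the lattice this is periodicity of \<wp>. Multiplied by theta it also holds
    trivially on the lattice, and the factor theta is then cancelled.\<close>
  have eqI: "G (x + lattice_point \<tau> q) = u x * G x"
    if "u holomorphic_on UNIV" "\<And>x. theta \<tau> (x + lattice_point \<tau> q) ^ 2 = u x * theta \<tau> x ^ 2" for q u x
  proof -
    have "(G (x + lattice_point \<tau> q) - u x * G x) * theta \<tau> x = 0" for x
    proof (cases "x \<in> ?L")
      case True then show ?thesis using theta_lattice_point by auto
    next
      case False
      then show ?thesis
        using that(2) [of x] shift [of x q] wp_periodic [OF \<tau>, of x q]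
        by (simp add: G_def wp_def del: weierstrass_p.simps)
    qed
    then have "G (x + lattice_point \<tau> q) - u x * G x = 0"
      by (intro entire_mult_eq_0 [of "\<lambda>x. G (x + lattice_point \<tau> q) - u x * G x" "theta \<tau>" a]
        holomorphic_intros that(1) G_shift hol theta_holomorphic \<tau> a)
    then show ?thesis by simp
  qed
  have "G (x + 1) = G x" for x
    using eqI [of "\<lambda>_. 1" "(1, 0)"] by (simp add: lattice_point_def theta_plus_1)
  moreover have "G (x + \<tau>) = theta_factor \<tau> x ^ 2 * G x" for x
    using eqI [of "\<lambda>x. theta_factor \<tau> x ^ 2" "(0, 1)"]
    by (simp add: lattice_point_def theta_plus_tau power_mult_distrib theta_factor_def holomorphic_intros)
  ultimately show "G \<in> theta2_space \<tau>"
    using hol by (simp add: theta2_space_def)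
qed

text \<open>The Fourier coefficients 0 and 1 are injective coordinates on
  \<open>theta2_space \<tau>\<close>. Two independent elements thus form a basis, and Cramer's rule
  gives the expansion.\<close>

lemma theta_product_expansion:
  assumes \<tau>: "Im \<tau> > 0" and G: "G \<in> theta2_space \<tau>"
    "\<And>x. x \<notin> range (lattice_point \<tau>) \<Longrightarrow> G x = weierstrass_p (Elliptic \<tau>) x * theta \<tau> x ^ 2"
  obtains \<alpha> \<beta> where "\<And>x. theta \<tau> (x + a) * theta \<tau> (x - a) = \<alpha> * theta \<tau> x ^ 2 + \<beta> * G x"
proof -
  define f where "f = (\<lambda>x. theta \<tau> x ^ 2)"
  have f: "f \<in> theta2_space \<tau>"
    using theta_product_in_theta2_space [OF \<tau>, of 0] by (simp add: f_def power2_eq_square)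
  have indep: "\<alpha> = 0 \<and> \<beta> = 0" if zero: "\<And>x. \<alpha> * f x + \<beta> * G x = 0" for \<alpha> \<beta>
  proof -
    obtain h r where r: "r > 0" and h: "h holomorphic_on ball 0 r"
      and wp_h: "\<forall>x\<in>ball 0 r. weierstrass_p (Elliptic \<tau>) x = 1 / x^2 + h x"
      and isolated: "\<forall>x\<in>ball 0 r. x \<noteq> 0 \<longrightarrow> x \<notin> range (lattice_point \<tau>)"
      using wp_pole_at_0 [OF \<tau>] by blast
    obtain c where c: "theta \<tau> c \<noteq> 0" using theta_not_identically_zero [OF \<tau>] .
    have "\<beta> = 0"
    proof (rule ccontr)
      assume "\<beta> \<noteq> 0"
      \<comment> \<open>This is x^2 (\<alpha> + \<beta> \<wp>(x)) with its removable singularity at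
        0 filled in; the value there is \<open>\<beta>\<close>. If it were nonzero, theta would
        vanish near 0 and so everywhere.\<close>
      define p where "p = (\<lambda>x. (\<alpha> + \<beta> * h x) * x ^ 2 + \<beta>)"
      have "continuous_on (ball 0 r) p"
        unfolding p_def by (intro continuous_intros holomorphic_on_imp_continuous_on h)
      moreover have "p 0 \<noteq> 0" using \<open>\<beta> \<noteq> 0\<close> by (simp add: p_def)
      ultimately obtain e where e: "e > 0" "\<forall>x\<in>ball 0 r. dist 0 x < e \<longrightarrow> p x \<noteq> 0"
        using continuous_on_avoid [of "ball 0 r" p 0 0] r by auto
      have near: "theta \<tau> x = 0" if x: "x \<in> ball 0 (min r e)" for x
      proof (cases "x = 0")
        case True
        then show ?thesis using theta_minus [of \<tau> 0] by simp
      next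
        case False
        have x': "x \<in> ball 0 r" "p x \<noteq> 0" using x e by auto
        have "0 = x ^ 2 * (\<alpha> * f x + \<beta> * G x)" using zero by simp
        also have "G x = (1 / x^2 + h x) * f x"
          using G(2) [OF isolated [rule_format, OF x'(1) False]] wp_h x' by (simp add: f_def del: weierstrass_p.simps)
        also have "x ^ 2 * (\<alpha> * f x + \<beta> * ((1 / x^2 + h x) * f x)) = p x * f x"
          using False by (simp add: p_def field_simps)
        finally show ?thesis using x' by (simp add: f_def)
      qed
      have "theta \<tau> c = 0"
        by (rule analytic_continuation_open [of "ball 0 (min r e)" UNIV "theta \<tau>" "\<lambda>_. 0"])
          (use r e near theta_holomorphic [OF \<tau>] in auto)
      with c show False by simp
    qed
    with zero [of c] c show ?thesis by (simp add: f_def)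
  qed
  define k where "k = (\<lambda>x. theta \<tau> (x + a) * theta \<tau> (x - a))"
  have k: "k \<in> theta2_space \<tau>" unfolding k_def by (rule theta_product_in_theta2_space [OF \<tau>])
  let ?A = "fourier_coeff"
  have hol: "u holomorphic_on UNIV" if "u \<in> theta2_space \<tau>" for u
    using that by (simp add: theta2_space_def)
  have vanish: "s * u x + t * v x = 0"
    if "u \<in> theta2_space \<tau>" "v \<in> theta2_space \<tau>"
      "s * ?A u 0 + t * ?A v 0 = 0" "s * ?A u 1 + t * ?A v 1 = 0" for u v s t x
    by (rule theta2_space_determined [OF theta2_space_lincomb])
      (use that in \<open>auto simp: fourier_coeff_lincomb hol\<close>)
  \<comment> \<open>If this determinant vanished, \<open>?A G i\<close> and \<open>- ?A f i\<close>
    would be the coefficients of a linear relation between \<open>f\<close> and \<open>G\<close>,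
    for \<open>i = 0\<close> and \<open>i = 1\<close>. By independence all four numbers would be 0,
    and \<open>f\<close> itself would vanish.\<close>
  define \<Delta> where "\<Delta> = ?A f 0 * ?A G 1 - ?A f 1 * ?A G 0"
  have "\<Delta> \<noteq> 0"
  proof
    assume \<Delta>: "\<Delta> = 0"
    have "?A G 0 = 0 \<and> - ?A f 0 = 0"
      by (rule indep, rule vanish [OF f G(1)]) (use \<Delta> in \<open>auto simp: \<Delta>_def algebra_simps\<close>)
    moreover have "?A G 1 = 0 \<and> - ?A f 1 = 0"
      by (rule indep, rule vanish [OF f G(1)]) (use \<Delta> in \<open>auto simp: \<Delta>_def algebra_simps\<close>)
    ultimately have "1 * f x + 0 * G x = 0" for x
      by (intro vanish [OF f G(1)]) auto
    then show False using indep [of 1 0] by simp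
  qed
  define \<alpha> where "\<alpha> = (?A k 0 * ?A G 1 - ?A k 1 * ?A G 0) / \<Delta>"
  define \<beta> where "\<beta> = (?A f 0 * ?A k 1 - ?A f 1 * ?A k 0) / \<Delta>"
  have fG: "(\<lambda>x. \<alpha> * f x + \<beta> * G x) \<in> theta2_space \<tau>"
    by (rule theta2_space_lincomb [OF f G(1)])
  have coeffs: "\<alpha> * \<Delta> = ?A k 0 * ?A G 1 - ?A k 1 * ?A G 0" "\<beta> * \<Delta> = ?A f 0 * ?A k 1 - ?A f 1 * ?A k 0"
    using \<open>\<Delta> \<noteq> 0\<close> by (simp_all add: \<alpha>_def \<beta>_def)
  have cramer: "(\<alpha> * u + \<beta> * v) * \<Delta> =
      (?A k 0 * ?A G 1 - ?A k 1 * ?A G 0) * u + (?A f 0 * ?A k 1 - ?A f 1 * ?A k 0) * v" for u v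
    unfolding coeffs [symmetric] by (simp add: algebra_simps)
  have "(\<alpha> * ?A f 0 + \<beta> * ?A G 0) * \<Delta> = ?A k 0 * \<Delta>" "(\<alpha> * ?A f 1 + \<beta> * ?A G 1) * \<Delta> = ?A k 1 * \<Delta>"
    unfolding cramer by (simp_all add: \<Delta>_def algebra_simps)
  then have "1 * k x + - 1 * (\<alpha> * f x + \<beta> * G x) = 0" for x
    using \<open>\<Delta> \<noteq> 0\<close> by (intro vanish [OF k fG]) (simp_all add: fourier_coeff_lincomb hol f G(1))
  then have "1 * k x + - 1 * (\<alpha> * f x + \<beta> * G x) + (\<alpha> * f x + \<beta> * G x) = \<alpha> * f x + \<beta> * G x" for x
    by (simp only: add_0)
  then have "k x = \<alpha> * f x + \<beta> * G x" for x
    by (simp only: mult_1 mult_minus1 minus_add_cancel add.assoc left_minus add_0_right)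
  then show ?thesis
    by (intro that) (simp add: k_def f_def)
qed

lemma theta_wp_relations:
  assumes \<tau>: "Im \<tau> > 0"
  shows theta_nonzero: "y \<notin> range (lattice_point \<tau>) \<Longrightarrow> theta \<tau> y \<noteq> 0"
    and theta_addition: "x \<notin> range (lattice_point \<tau>) \<Longrightarrow> y \<notin> range (lattice_point \<tau>) \<Longrightarrow>
      deriv (theta \<tau>) 0 ^ 2 * (theta \<tau> (x + y) * theta \<tau> (x - y)) =
      - (weierstrass_p (Elliptic \<tau>) x - weierstrass_p (Elliptic \<tau>) y) * (theta \<tau> x ^ 2 * theta \<tau> y ^ 2)"
proof -
  define wp where "wp = weierstrass_p (Elliptic \<tau>)"
  obtain G where G: "G \<in> theta2_space \<tau>"
    and wp: "\<And>x. x \<notin> range (lattice_point \<tau>) \<Longrightarrow> G x = weierstrass_p (Elliptic \<tau>) x * theta \<tau> x ^ 2"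
    and G0: "G 0 = deriv (theta \<tau>) 0 ^ 2"
    using wp_theta_in_theta2_space [OF \<tau>] by blast
  have wp': "G x = wp x * theta \<tau> x ^ 2" if "x \<notin> range (lattice_point \<tau>)" for x
    using wp [OF that] by (simp only: wp_def)
  \<comment> \<open>By the expansion a common zero would be a zero of
    \<open>theta \<tau> (y + a) * theta \<tau> (y - a)\<close> for every \<open>a\<close>. Off the
    lattice a zero of theta is also one of \<open>G\<close>.\<close>
  have common_zero: False if "theta \<tau> y = 0" "G y = 0" for y
  proof -
    obtain a where a: "theta \<tau> (y + a) * theta \<tau> (y - a) \<noteq> 0"
      using theta_product_nonzero [OF \<tau>] .
    obtain \<alpha> \<beta> where "\<And>x. theta \<tau> (x + a) * theta \<tau> (x - a) = \<alpha> * theta \<tau> x ^ 2 + \<beta> * G x"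
      using theta_product_expansion [OF \<tau> G wp] by blast
    from this [of y] a that show False by simp
  qed
  have theta0: "theta \<tau> 0 = 0" using theta_minus [of \<tau> 0] by simp
  show nonzero: "theta \<tau> y \<noteq> 0" if "y \<notin> range (lattice_point \<tau>)" for y
    using common_zero [of y] wp' [OF that] by auto
  assume x: "x \<notin> range (lattice_point \<tau>)" and y: "y \<notin> range (lattice_point \<tau>)"
  obtain \<alpha> \<beta> where e: "\<And>x. theta \<tau> (x + y) * theta \<tau> (x - y) = \<alpha> * theta \<tau> x ^ 2 + \<beta> * G x"
    using theta_product_expansion [OF \<tau> G wp] by blast
  \<comment> \<open>Evaluation at \<open>y\<close>, where the left side of the expansion contains
    theta(0) = 0, fixes the ratio of the two coefficients; evaluation at 0 then fixes
    \<open>\<beta>\<close>.\<close>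
  have "(\<alpha> + \<beta> * wp y) * theta \<tau> y ^ 2 = 0"
    using e [of y] theta0 wp' [OF y] by (simp add: algebra_simps)
  then have \<alpha>: "\<alpha> = - (\<beta> * wp y)"
    using nonzero [OF y] by (simp add: eq_neg_iff_add_eq_0)
  have \<beta>: "- (theta \<tau> y ^ 2) = \<beta> * deriv (theta \<tau>) 0 ^ 2"
    using e [of 0] theta0 theta_minus [of \<tau> y] G0 by (simp add: power2_eq_square)
  have "theta \<tau> (x + y) * theta \<tau> (x - y) = \<beta> * ((wp x - wp y) * theta \<tau> x ^ 2)"
    using e [of x] \<alpha> wp' [OF x] by (simp add: algebra_simps)
  then have "deriv (theta \<tau>) 0 ^ 2 * (theta \<tau> (x + y) * theta \<tau> (x - y)) =
      (\<beta> * deriv (theta \<tau>) 0 ^ 2) * ((wp x - wp y) * theta \<tau> x ^ 2)"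
    by simp
  then have "deriv (theta \<tau>) 0 ^ 2 * (theta \<tau> (x + y) * theta \<tau> (x - y)) =
      - (wp x - wp y) * (theta \<tau> x ^ 2 * theta \<tau> y ^ 2)"
    unfolding \<beta> [symmetric] by (simp add: algebra_simps)
  then show "deriv (theta \<tau>) 0 ^ 2 * (theta \<tau> (x + y) * theta \<tau> (x - y)) =
      - (weierstrass_p (Elliptic \<tau>) x - weierstrass_p (Elliptic \<tau>) y) * (theta \<tau> x ^ 2 * theta \<tau> y ^ 2)"
    by (simp only: wp_def)
qed

subsection \<open>The Kronecker function\<close>

lemma weierstrass_p_minus: "weierstrass_p \<kappa> (- x) = weierstrass_p \<kappa> x"
  by (cases \<kappa>) (simp_all only: wp_minus, simp_all)

lemma minus_in_pole_set_iff: "- x \<in> pole_set \<kappa> \<longleftrightarrow> x \<in> pole_set \<kappa>"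
proof -
  have "- x \<in> range (lattice_point \<tau>)" if "x \<in> range (lattice_point \<tau>)" for x \<tau>
  proof -
    from that obtain p where "x = lattice_point \<tau> p" by blast
    then have "- x = lattice_point \<tau> (- p)" by (simp add: lattice_point_def split_beta)
    then show ?thesis by blast
  qed
  from this [of x] this [of "- x"] show ?thesis by (cases \<kappa>) auto
qed

text \<open>The trigonometric and rational cases are differences of squares, with coth^2 = 1 +
  1/sinh^2. The elliptic case is the addition theorem for theta, its sign absorbed by the oddness of
  theta.\<close>

lemma kronecker_phi_product:
  assumes \<kappa>: "admissible \<kappa>" and x: "x \<notin> pole_set \<kappa>" and y: "y \<notin> pole_set \<kappa>"
  shows "kronecker_phi \<kappa> x y * kronecker_phi \<kappa> x (- y) = weierstrass_p \<kappa> x - weierstrass_p \<kappa> y"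
proof (cases \<kappa>)
  case (Elliptic \<tau>)
  then have \<tau>: "Im \<tau> > 0" and L: "x \<notin> range (lattice_point \<tau>)" "y \<notin> range (lattice_point \<tau>)"
    using assms by auto
  define D where "D = weierstrass_p (Elliptic \<tau>) x - weierstrass_p (Elliptic \<tau>) y"
  have nz: "theta \<tau> x \<noteq> 0" "theta \<tau> y \<noteq> 0"
    using theta_nonzero [OF \<tau>] L by auto
  have "kronecker_phi \<kappa> x y * kronecker_phi \<kappa> x (- y) =
      - (deriv (theta \<tau>) 0 ^ 2 * (theta \<tau> (x + y) * theta \<tau> (x - y))) / (theta \<tau> x ^ 2 * theta \<tau> y ^ 2)"
    by (simp add: Elliptic theta_minus power2_eq_square mult_ac)
  also have "\<dots> = D * (theta \<tau> x ^ 2 * theta \<tau> y ^ 2) / (theta \<tau> x ^ 2 * theta \<tau> y ^ 2)"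
    using theta_addition [OF \<tau> L] by (simp only: D_def [symmetric]) simp
  also have "\<dots> = D" using nz by simp
  finally show ?thesis by (simp only: D_def Elliptic)
next
  case Trigonometric
  with x y have nz: "sinh x \<noteq> 0" "sinh y \<noteq> 0" by auto
  have "kronecker_phi \<kappa> x y * kronecker_phi \<kappa> x (- y) = cosh x ^ 2 / sinh x ^ 2 - cosh y ^ 2 / sinh y ^ 2"
    by (simp add: Trigonometric power2_eq_square algebra_simps)
  also have "\<dots> = 1 / sinh x ^ 2 - 1 / sinh y ^ 2"
    using nz by (simp add: cosh_square_eq add_divide_distrib)
  finally show ?thesis by (simp add: Trigonometric)
next
  case Rational
  with x y have nz: "x \<noteq> 0" "y \<noteq> 0" by auto
  then show ?thesis
    by (simp add: Rational power2_eq_square algebra_simps inverse_eq_divide)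
qed

subsection \<open>Open dense sets\<close>

text \<open>Openness is part of the notion because density alone is not preserved by finite
  intersections.\<close>

definition generic :: "'a::topological_space set \<Rightarrow> bool" where
  "generic S \<longleftrightarrow> open S \<and> closure S = UNIV"

lemma generic_Int:
  assumes "generic S" "generic T"
  shows "generic (S \<inter> T)"
proof -
  have "S \<subseteq> closure (S \<inter> T)"
    using open_Int_closure_subset [of S T] assms by (simp add: generic_def)
  then have "closure S \<subseteq> closure (S \<inter> T)"
    by (simp add: closure_minimal)
  then show ?thesis using assms by (auto simp: generic_def)
qed

lemma generic_INT:
  assumes "finite I" "\<And>i. i \<in> I \<Longrightarrow> generic (S i)"
  shows "generic (\<Inter>i\<in>I. S i)"
  using assms
proof (induction I rule: finite_induct)
  case empty
  then show ?case by (simp add: generic_def)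
next
  case (insert i I)
  then show ?case using generic_Int [of "S i" "\<Inter>i\<in>I. S i"] by simp
qed

lemma generic_Times: "generic S \<Longrightarrow> generic T \<Longrightarrow> generic (S \<times> T)"
  by (simp add: generic_def open_Times closure_Times)

text \<open>A surjective linear map is open, so a nonempty open set missing the preimage would have
  an open image missing \<open>S\<close>. All arguments of \<open>R\<close> in the relations below
  are linear in the variables.\<close>

lemma generic_linear_vimage:
  fixes f :: "'a::euclidean_space \<Rightarrow> 'b::euclidean_space"
  assumes f: "linear f" "surj f" and S: "generic S"
  shows "generic (f -` S)"
proof -
  have "open (f -` S)"
    using S linear_continuous_on [OF linear_conv_bounded_linear [THEN iffD1, OF f(1)]]
    by (intro open_vimage) (auto simp: generic_def)
  moreover have "closure (f -` S) = UNIV"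
  proof (rule ccontr)
    assume "closure (f -` S) \<noteq> UNIV"
    then have ne: "f ` (- closure (f -` S)) \<noteq> {}" by blast
    have "open (f ` (- closure (f -` S)))"
      by (rule open_surjective_linear_image) (use f in auto)
    then have "f ` (- closure (f -` S)) \<inter> S \<noteq> {}"
      using open_Int_closure_eq_empty [of _ S] S ne by (auto simp: generic_def)
    then show False using closure_subset [of "f -` S"] by blast
  qed
  ultimately show ?thesis by (simp add: generic_def)
qed

lemma continuous_eq_on_dense:
  fixes f g :: "'a::topological_space \<Rightarrow> 'b::real_normed_vector"
  assumes W: "open W" and S: "closure S = UNIV"
    and f: "continuous_on W f" and g: "continuous_on W g"
    and eq: "\<And>p. p \<in> W \<Longrightarrow> p \<in> S \<Longrightarrow> f p = g p" and p: "p \<in> W"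
  shows "f p = g p"
proof (rule ccontr)
  assume "f p \<noteq> g p"
  define U where "U = W \<inter> (\<lambda>p. f p - g p) -` (- {0})"
  have "open U"
    unfolding U_def by (intro continuous_open_preimage continuous_intros f g W)
  moreover have "p \<in> U" using p \<open>f p \<noteq> g p\<close> by (simp add: U_def)
  ultimately have "U \<inter> S \<noteq> {}"
    using open_Int_closure_eq_empty [of U S] S by auto
  then show False using eq by (auto simp: U_def)
qed

lemma generic_compl_pole_set:
  assumes "admissible \<kappa>"
  shows "generic (- pole_set \<kappa>)"
proof -
  have "closed (pole_set \<kappa>) \<and> interior (pole_set \<kappa>) = {}"
  proof (cases \<kappa>)
    case (Elliptic \<tau>)
    then have \<tau>: "Im \<tau> > 0" using assms by simp
    have "interior (range (lattice_point \<tau>)) = {}"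
      using interior_limit_point lattice_not_islimpt [OF \<tau>] by blast
    then show ?thesis using closed_lattice [OF \<tau>] by (simp add: Elliptic)
  next
    case Trigonometric
    have sinh: "(sinh :: complex \<Rightarrow> complex) holomorphic_on UNIV"
      by (auto simp: sinh_def [abs_def] intro!: holomorphic_intros)
    have "closed {x :: complex. sinh x = 0}"
      by (intro closed_Collect_eq continuous_intros)
    moreover have "interior {x :: complex. sinh x = 0} = {}"
    proof (rule ccontr)
      assume ne: "interior {x :: complex. sinh x = 0} \<noteq> {}"
      have "sinh (1 :: complex) = 0"
        by (rule analytic_continuation_open [of "interior {x :: complex. sinh x = 0}" UNIV sinh "\<lambda>_. 0"])
          (use ne sinh interior_subset in auto)
      then have "cmod (exp 1) = 1" by (auto simp: sinh_zero_iff simp del: norm_exp_eq_Re)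
      then show False by (simp add: norm_exp)
    qed
    ultimately show ?thesis by (simp add: Trigonometric)
  next
    case Rational
    then show ?thesis by simp
  qed
  then show ?thesis by (simp add: generic_def closure_complement open_Compl)
qed

lemma continuous_on_weierstrass_p:
  assumes "admissible \<kappa>"
  shows "continuous_on (- pole_set \<kappa>) (weierstrass_p \<kappa>)"
proof (cases \<kappa>)
  case (Elliptic \<tau>)
  with assms have "continuous_on (- range (lattice_point \<tau>)) (weierstrass_p (Elliptic \<tau>))"
    by (intro holomorphic_on_imp_continuous_on wp_holomorphic) simp
  then show ?thesis by (simp only: Elliptic pole_set.simps)
next
  case Trigonometric
  have "continuous_on (- {x :: complex. sinh x = 0}) (\<lambda>x. 1 / sinh x ^ 2)"
    by (intro continuous_intros) auto
  then show ?thesis by (simp add: Trigonometric)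
next
  case Rational
  have "continuous_on (- {0 :: complex}) (\<lambda>x. 1 / x ^ 2)"
    by (intro continuous_intros) auto
  then show ?thesis by (simp add: Rational)
qed

subsection \<open>Tensor legs\<close>

lemma sum_single:
  assumes "finite A" "a \<in> A" "\<And>x. x \<in> A \<Longrightarrow> x \<noteq> a \<Longrightarrow> f x = 0"
  shows "sum f A = f a"
  using assms by (simp add: sum.remove [of A a] sum.neutral)

lemma leg12_entry: "leg12 A $ (a, b, c) $ (a', b', c') = (if c = c' then A $ (a, b) $ (a', b') else 0)"
  unfolding leg12_def sum_component
  by (subst sum_single [of _ "(a, a', b, b')"])
    (auto simp: smult_mat_def tens_def munit_def mat_def split: if_splits)

lemma leg13_entry: "leg13 A $ (a, b, c) $ (a', b', c') = (if b = b' then A $ (a, c) $ (a', c') else 0)"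
  unfolding leg13_def sum_component
  by (subst sum_single [of _ "(a, a', c, c')"])
    (auto simp: smult_mat_def tens_def munit_def mat_def split: if_splits)

lemma leg23_entry: "leg23 A $ (a, b, c) $ (a', b', c') = (if a = a' then A $ (b, c) $ (b', c') else 0)"
  unfolding leg23_def sum_component
  by (subst sum_single [of _ "(b, b', c, c')"])
    (auto simp: smult_mat_def tens_def munit_def mat_def split: if_splits)

lemmas leg_entry = leg12_entry leg13_entry leg23_entry

lemma perm_mat_entry: "perm_mat $ (a, b) $ (a', b') = (if a = b' \<and> b = a' then 1 else 0)"
  unfolding perm_mat_def sum_component
  by (subst sum_single [of _ "(a, b)"])
    (auto simp: tens_def munit_def split: if_splits)

lemma leg21_entry: "leg21 A $ (a, b) $ (a', b') = A $ (b, a) $ (b', a')"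
proof -
  have l: "(perm_mat ** B) $ (a, b) $ p = B $ (b, a) $ p" for B p
    unfolding matrix_matrix_mult_def vec_lambda_beta
    by (subst sum_single [of _ "(b, a)"]) (auto simp: perm_mat_entry split: if_splits)
  have r: "(B ** perm_mat) $ p $ (a', b') = B $ p $ (b', a')" for B p
    unfolding matrix_matrix_mult_def vec_lambda_beta
    by (subst sum_single [of _ "(b', a')"]) (auto simp: perm_mat_entry split: if_splits)
  show ?thesis by (simp add: leg21_def r l)
qed

lemma leg_linear:
  "leg12 (A + B) = leg12 A + leg12 B" "leg13 (A + B) = leg13 A + leg13 B" "leg23 (A + B) = leg23 A + leg23 B"
  "leg12 (c *\<^sub>m A) = c *\<^sub>m leg12 A" "leg13 (c *\<^sub>m A) = c *\<^sub>m leg13 A" "leg23 (c *\<^sub>m A) = c *\<^sub>m leg23 A"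
  "leg12 (- A) = - leg12 A" "leg13 (- A) = - leg13 A" "leg23 (- A) = - leg23 A"
  "leg12 0 = 0" "leg13 0 = 0" "leg23 0 = 0"
  "leg12 (mat 1) = mat 1" "leg13 (mat 1) = mat 1" "leg23 (mat 1) = mat 1"
  by (auto simp: vec_eq_iff leg_entry smult_mat_def mat_def split_paired_all)

lemma leg12_mult: "leg12 A ** leg12 B = leg12 (A ** B)"
proof -
  have "(leg12 A ** leg12 B) $ (a, b, c) $ (a', b', c') = leg12 (A ** B) $ (a, b, c) $ (a', b', c')" for a b c a' b' c'
  proof -
    have "(leg12 A ** leg12 B) $ (a, b, c) $ (a', b', c') =
      (\<Sum>r\<in>UNIV. leg12 A $ (a, b, c) $ r * leg12 B $ r $ (a', b', c'))"
      by (simp add: matrix_matrix_mult_def)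
    also have "\<dots> = (\<Sum>r\<in>(\<lambda>(i, j). (i, j, c)) ` UNIV. leg12 A $ (a, b, c) $ r * leg12 B $ r $ (a', b', c'))"
      by (rule sum.mono_neutral_right) (auto simp: leg_entry image_def)
    also have "\<dots> = (\<Sum>(i, j)\<in>UNIV. leg12 A $ (a, b, c) $ (i, j, c) * leg12 B $ (i, j, c) $ (a', b', c'))"
      by (subst sum.reindex) (auto simp: inj_on_def split_beta)
    also have "\<dots> = leg12 (A ** B) $ (a, b, c) $ (a', b', c')"
      by (auto simp: leg_entry matrix_matrix_mult_def split_beta)
    finally show ?thesis .
  qed
  then show ?thesis by (simp add: vec_eq_iff)
qed

text \<open>Conjugation by the permutation of components 2 and 3, written as a relabelling of
  indices.\<close>

definition swap23 :: "('n::finite \<times> 'n \<times> 'n) cmat \<Rightarrow> ('n \<times> 'n \<times> 'n) cmat" where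
  "swap23 A = (\<chi> s t. A $ (fst s, snd (snd s), fst (snd s)) $ (fst t, snd (snd t), fst (snd t)))"

lemma swap23_mult: "swap23 (A ** B) = swap23 A ** swap23 B"
proof -
  have "(\<Sum>k\<in>UNIV. A $ p $ k * B $ k $ p') =
      (\<Sum>k\<in>UNIV. A $ p $ (fst k, snd (snd k), fst (snd k)) * B $ (fst k, snd (snd k), fst (snd k)) $ p')" for p p'
    by (rule sum.reindex_bij_witness [of _ "\<lambda>(a, b, c). (a, c, b)" "\<lambda>(a, b, c). (a, c, b)"]) auto
  then show ?thesis by (simp add: swap23_def matrix_matrix_mult_def vec_eq_iff)
qed

lemma swap23_add: "swap23 (A + B) = swap23 A + swap23 B"
  by (simp add: swap23_def vec_eq_iff)

lemma swap23_leg: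
  "swap23 (leg12 A) = leg13 A" "swap23 (leg13 A) = leg12 A" "swap23 (leg23 A) = leg23 (leg21 A)"
  by (auto simp: swap23_def vec_eq_iff leg_entry leg21_entry split_paired_all)

lemma matrix_minus_mult: "(- A) ** B = - (A ** B)" "A ** (- B) = - (A ** B)"
    "A ** (B - C) = A ** B - A ** C" for A B C :: "'i::finite cmat"
  by (simp_all add: matrix_matrix_mult_def vec_eq_iff sum_negf sum_subtractf algebra_simps)

lemma matrix_add_mult: "(A + B) ** C = A ** C + B ** C" "A ** (B + C) = A ** B + A ** C"
  for A B C :: "'i::finite cmat"
  by (simp_all add: matrix_matrix_mult_def vec_eq_iff sum.distrib algebra_simps)

lemma continuous_on_matrix_mult [continuous_intros]:
  fixes f g :: "_ \<Rightarrow> 'i::finite cmat"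
  assumes "continuous_on S f" "continuous_on S g"
  shows "continuous_on S (\<lambda>p. f p ** g p)"
  unfolding matrix_matrix_mult_def by (intro continuous_intros assms)

lemma continuous_on_smult_mat [continuous_intros]:
  assumes "continuous_on S c" "continuous_on S f"
  shows "continuous_on S (\<lambda>p. c p *\<^sub>m f p)"
  unfolding smult_mat_def by (intro continuous_intros assms)

lemma continuous_on_leg [continuous_intros]:
  assumes "continuous_on S f"
  shows "continuous_on S (\<lambda>p. leg12 (f p))" "continuous_on S (\<lambda>p. leg13 (f p))" "continuous_on S (\<lambda>p. leg23 (f p))"
  unfolding leg12_def leg13_def leg23_def split_beta by (intro continuous_intros assms)+


subsection \<open>Consequences of the associative Yang-Baxter equation\<close>

locale associative_YB =
  fixes \<kappa> :: fun_type
    and R :: "complex \<Rightarrow> complex \<Rightarrow> ('n::finite \<times> 'n) cmat"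
    and D :: "(complex \<times> complex) set"
  assumes adm: "admissible \<kappa>"
    and open_D: "open D" and dense_D: "closure D = UNIV" and cont_R: "continuous_on D (\<lambda>(h, z). R h z)"
    and AYBE: "\<And>h \<eta> z1 z2 z3.
      \<lbrakk>(h, z1 - z2) \<in> D; (\<eta>, z2 - z3) \<in> D; (\<eta>, z1 - z3) \<in> D; (h - \<eta>, z1 - z2) \<in> D;
        (\<eta> - h, z2 - z3) \<in> D; (h, z1 - z3) \<in> D\<rbrakk> \<Longrightarrow>
      leg12 (R h (z1 - z2)) ** leg23 (R \<eta> (z2 - z3)) =
        leg13 (R \<eta> (z1 - z3)) ** leg12 (R (h - \<eta>) (z1 - z2)) +
        leg23 (R (\<eta> - h) (z2 - z3)) ** leg13 (R h (z1 - z3))"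
    and skew: "\<And>h z. \<lbrakk>(h, z) \<in> D; (- h, - z) \<in> D\<rbrakk> \<Longrightarrow> R h z = - leg21 (R (- h) (- z))"
    and unitarity: "\<And>h z. \<lbrakk>(h, z) \<in> D; (h, - z) \<in> D; h \<notin> pole_set \<kappa>; z \<notin> pole_set \<kappa>\<rbrakk> \<Longrightarrow>
      R h z ** leg21 (R h (- z)) =
        (weierstrass_p \<kappa> h - weierstrass_p \<kappa> z) *\<^sub>m (mat 1 \<otimes>\<^sub>m mat 1)"
begin

lemma AYBE':
  assumes "(h, u) \<in> D" "(\<eta>, v) \<in> D" "(\<eta>, u + v) \<in> D" "(h - \<eta>, u) \<in> D" "(\<eta> - h, v) \<in> D" "(h, u + v) \<in> D"
  shows "leg12 (R h u) ** leg23 (R \<eta> v) =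
    leg13 (R \<eta> (u + v)) ** leg12 (R (h - \<eta>) u) + leg23 (R (\<eta> - h) v) ** leg13 (R h (u + v))"
  using AYBE [of h "u + v" v \<eta> 0] assms by simp

text \<open>\<open>D\<close> may fail to be symmetric, whereas skew-symmetry and unitarity involve
  negated arguments; \<open>D0\<close> makes all sign changes admissible at once.\<close>

definition D0 :: "(complex \<times> complex) set" where
  "D0 = (\<Inter>s\<in>{1, - 1}. \<Inter>t\<in>{1, - 1}. (\<lambda>p. (s * fst p, t * snd p)) -` (D \<inter> (- pole_set \<kappa>) \<times> (- pole_set \<kappa>)))"

lemma generic_D0: "generic D0"
  unfolding D0_def
proof (intro generic_INT generic_linear_vimage)
  fix s t :: complex assume "s \<in> {1, - 1}" "t \<in> {1, - 1}"
  then have st: "s \<noteq> 0" "t \<noteq> 0" by auto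
  show "linear (\<lambda>p. (s * fst p, t * snd p))"
    by (rule linearI) (auto simp: algebra_simps)
  show "surj (\<lambda>p. (s * fst p, t * snd p))"
    unfolding surj_def
  proof
    fix y :: "complex \<times> complex"
    show "\<exists>x. y = (s * fst x, t * snd x)"
      using st by (intro exI [of _ "(fst y / s, snd y / t)"]) auto
  qed
  show "generic (D \<inter> (- pole_set \<kappa>) \<times> (- pole_set \<kappa>))"
    using open_D dense_D
    by (intro generic_Int generic_Times generic_compl_pole_set adm) (simp add: generic_def)
qed auto

lemma D0_D:
  assumes "(h, z) \<in> D0"
  shows "(h, z) \<in> D" "h \<notin> pole_set \<kappa>" "z \<notin> pole_set \<kappa>"
  using assms by (auto simp: D0_def)

lemma D0_minus:
  assumes "(h, z) \<in> D0"
  shows "(- h, z) \<in> D0" "(h, - z) \<in> D0" "(- h, - z) \<in> D0"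
  using assms by (auto simp: D0_def)

text \<open>Skew-symmetry removes the exchange of components from unitarity. In this form two
  adjacent factors with the same spectral argument collapse to a scalar.\<close>

lemma R_mult_R_minus:
  assumes "(h, z) \<in> D0"
  shows "R h z ** R (- h) z = - ((weierstrass_p \<kappa> h - weierstrass_p \<kappa> z) *\<^sub>m mat 1)"
proof -
  have "R (- h) z = - leg21 (R h (- z))"
    using skew [of "- h" z] D0_minus [OF assms] D0_D by simp
  moreover have "R h z ** leg21 (R h (- z)) = (weierstrass_p \<kappa> h - weierstrass_p \<kappa> z) *\<^sub>m (mat 1 \<otimes>\<^sub>m mat 1)"
    using D0_minus [OF assms] D0_D assms by (intro unitarity) blast+
  ultimately show ?thesis by (simp add: matrix_minus_mult tens_one)
qed

text \<open>
  This is the associative Yang-Baxter equation with the components 2 and 3 exchanged, where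
  skew-symmetry turns \<open>R\<^sub>3\<^sub>2\<close> into \<open>R\<^sub>2\<^sub>3\<close>.
\<close>

lemma AYBE_swapped_D0:
  assumes D0: "\<And>a c. a \<in> {x, y, x + y} \<Longrightarrow> c \<in> {u, v, u + v} \<Longrightarrow> (a, c) \<in> D0"
  shows "leg12 (R x u) ** leg13 (R y (u + v)) + leg13 (R (x + y) (u + v)) ** leg23 (R (- x) v) =
    leg23 (R y v) ** leg12 (R (x + y) u)"
proof -
  have *: "(a, c) \<in> D" "(- a, c) \<in> D" "(a, - c) \<in> D" "(- a, - c) \<in> D"
    if "a \<in> {x, y, x + y}" "c \<in> {u, v, u + v}" for a c
    using D0 [OF that] D0_minus [OF D0 [OF that]] D0_D by blast+
  \<comment> \<open>The associative equation at the parameters \<open>x + y\<close>,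
    \<open>x\<close> and the spectral arguments \<open>u + v\<close>, \<open>- v\<close>, which
    become those for the pairs 13 and 23 after the exchange.\<close>
  have "leg12 (R (x + y) (u + v)) ** leg23 (R x (- v)) =
      leg13 (R x (u + v + - v)) ** leg12 (R (x + y - x) (u + v)) +
      leg23 (R (x - (x + y)) (- v)) ** leg13 (R (x + y) (u + v + - v))"
    using * by (intro AYBE') simp_all
  then have "swap23 (leg12 (R (x + y) (u + v)) ** leg23 (R x (- v))) =
      swap23 (leg13 (R x u) ** leg12 (R y (u + v)) + leg23 (R (- y) (- v)) ** leg13 (R (x + y) u))"
    by simp
  then have "leg13 (R (x + y) (u + v)) ** leg23 (leg21 (R x (- v))) =
      leg12 (R x u) ** leg13 (R y (u + v)) + leg23 (leg21 (R (- y) (- v))) ** leg12 (R (x + y) u)"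
    by (simp add: swap23_mult swap23_add swap23_leg)
  moreover have "R (- x) v = - leg21 (R x (- v))"
    using skew [of "- x" v] * by simp
  moreover have "R y v = - leg21 (R (- y) (- v))"
    using skew [of y v] * by simp
  ultimately show ?thesis
    by (simp add: leg_linear matrix_minus_mult add_eq_0_iff)
qed

text \<open>The exchanged equation at \<open>- x\<close> and \<open>x + y\<close> rewrites
  \<open>leg13 (R y (u + v)) ** leg23 (R x v)\<close>; after multiplication by
  \<open>leg12 (R x u)\<close>, the associative equation applies to the product of legs 12 and 23.
  What remains are the scalars \<open>ux\<close> and \<open>uy\<close>, whose difference is free of
  \<wp>(u).\<close>

lemma cubic_D0:
  assumes D0: "\<And>a c. a \<in> {x, y, x + y} \<Longrightarrow> c \<in> {u, v, u + v} \<Longrightarrow> (a, c) \<in> D0"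
  shows "leg12 (R x u) ** (leg13 (R y (u + v)) ** leg23 (R x v)) =
    leg23 (R y v) ** (leg13 (R x (u + v)) ** leg12 (R y u)) +
    (weierstrass_p \<kappa> x - weierstrass_p \<kappa> y) *\<^sub>m leg13 (R (x + y) (u + v))"
proof -
  have *: "(a, c) \<in> D" "(- a, c) \<in> D"
    if "a \<in> {x, y, x + y}" "c \<in> {u, v, u + v}" for a c
    using D0 [OF that] D0_minus [OF D0 [OF that]] D0_D by blast+
  have swapped: "leg12 (R (- x) u) ** leg13 (R (x + y) (u + v)) + leg13 (R y (u + v)) ** leg23 (R x v) =
      leg23 (R (x + y) v) ** leg12 (R y u)"
    using AYBE_swapped_D0 [of "- x" "x + y" u v] D0 D0_minus by auto
  have aybe: "leg12 (R x u) ** leg23 (R (x + y) v) =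
      leg13 (R (x + y) (u + v)) ** leg12 (R (- y) u) + leg23 (R y v) ** leg13 (R x (u + v))"
    using AYBE' [of x u "x + y" v] * by simp
  have ux: "leg12 (R x u) ** leg12 (R (- x) u) = - ((weierstrass_p \<kappa> x - weierstrass_p \<kappa> u) *\<^sub>m mat 1)"
    using R_mult_R_minus [of x u] D0 by (simp add: leg12_mult leg_linear)
  have uy: "leg12 (R (- y) u) ** leg12 (R y u) = - ((weierstrass_p \<kappa> y - weierstrass_p \<kappa> u) *\<^sub>m mat 1)"
    using R_mult_R_minus [of "- y" u] D0 D0_minus by (simp add: leg12_mult leg_linear weierstrass_p_minus)
  have "leg12 (R x u) ** (leg13 (R y (u + v)) ** leg23 (R x v)) =
      leg12 (R x u) ** (leg23 (R (x + y) v) ** leg12 (R y u) - leg12 (R (- x) u) ** leg13 (R (x + y) (u + v)))"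
    unfolding swapped [symmetric] by simp
  also have "\<dots> = (leg12 (R x u) ** leg23 (R (x + y) v)) ** leg12 (R y u) -
      (leg12 (R x u) ** leg12 (R (- x) u)) ** leg13 (R (x + y) (u + v))"
    by (simp add: matrix_minus_mult matrix_mul_assoc)
  also have "\<dots> = leg13 (R (x + y) (u + v)) ** (leg12 (R (- y) u) ** leg12 (R y u)) +
      leg23 (R y v) ** (leg13 (R x (u + v)) ** leg12 (R y u)) -
      (leg12 (R x u) ** leg12 (R (- x) u)) ** leg13 (R (x + y) (u + v))"
    unfolding aybe by (simp add: matrix_add_mult matrix_mul_assoc)
  also have "\<dots> = leg23 (R y v) ** (leg13 (R x (u + v)) ** leg12 (R y u)) +
      (weierstrass_p \<kappa> x - weierstrass_p \<kappa> y) *\<^sub>m leg13 (R (x + y) (u + v))"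
    unfolding ux uy
    by (simp add: matrix_minus_mult smult_mult) (simp add: smult_mat_def vec_eq_iff algebra_simps)
  finally show ?thesis .
qed

text \<open>
  Here \<open>u\<close> and \<open>v\<close> stand for \<open>z\<^sub>1\<^sub>2\<close> and \<open>z\<^sub>2\<^sub>3\<close>. The pair \<open>(2, 0)\<close> serves the cubic relation at \<open>x = y\<close>,
  which gives the Yang-Baxter equation.
\<close>

definition D4 :: "(complex \<times> complex \<times> complex \<times> complex) set" where
  "D4 = (\<Inter>s\<in>{(1, 0), (0, 1), (1, 1), (2, 0)}. \<Inter>t\<in>{(1, 0), (0, 1), (1, 1)}.
     (\<lambda>(x, y, u, v). (fst s * x + snd s * y, fst t * u + snd t * v)) -` D0)"

lemma dense_D4: "closure D4 = UNIV"
proof -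
  have gen: "generic ((\<lambda>(x, y, u, v). (a * x + b * y, c * u + d * v)) -` D0)"
    if ab: "a \<noteq> 0 \<or> b \<noteq> 0" and cd: "c \<noteq> 0 \<or> d \<noteq> 0" for a b c d :: complex
  proof (rule generic_linear_vimage [OF _ _ generic_D0])
    show "linear (\<lambda>(x, y, u, v). (a * x + b * y, c * u + d * v))"
      by (rule linearI) (auto simp: algebra_simps)
    have solve: "\<exists>x y. a * x + b * y = w" if "a \<noteq> 0 \<or> b \<noteq> 0" for a b w :: complex
    proof (cases "a = 0")
      case True
      with that have "a * 0 + b * (w / b) = w" by simp
      then show ?thesis by blast
    next
      case False
      then have "a * (w / a) + b * 0 = w" by simp
      then show ?thesis by blast
    qed
    show "surj (\<lambda>(x, y, u, v). (a * x + b * y, c * u + d * v))"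
      unfolding surj_def
    proof
      fix p :: "complex \<times> complex"
      obtain x y where "a * x + b * y = fst p" using solve [OF ab] by blast
      moreover obtain u v where "c * u + d * v = snd p" using solve [OF cd] by blast
      ultimately show "\<exists>t. p = (case t of (x, y, u, v) \<Rightarrow> (a * x + b * y, c * u + d * v))"
        by (intro exI [of _ "(x, y, u, v)"]) auto
    qed
  qed
  have "generic D4"
    unfolding D4_def by (intro generic_INT gen) auto
  then show ?thesis by (simp add: generic_def)
qed

lemma D4_D0:
  assumes "(x, y, u, v) \<in> D4"
  shows "a \<in> {x, y, x + y} \<Longrightarrow> c \<in> {u, v, u + v} \<Longrightarrow> (a, c) \<in> D0"
    and "a \<in> {x, x, x + x} \<Longrightarrow> c \<in> {u, v, u + v} \<Longrightarrow> (a, c) \<in> D0"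
  using assms by (auto simp: D4_def simp flip: mult_2)

lemma continuous_on_R:
  assumes "continuous_on W f" "continuous_on W g" "\<And>p. p \<in> W \<Longrightarrow> (f p, g p) \<in> D"
  shows "continuous_on W (\<lambda>p. R (f p) (g p))"
  using continuous_on_compose2 [OF cont_R continuous_on_Pair [OF assms(1,2)]] assms(3) by auto

lemma open_R_domain:
  fixes f g :: "'a::topological_space \<Rightarrow> complex"
  assumes "continuous_on UNIV f" "continuous_on UNIV g"
  shows "open {p. (f p, g p) \<in> D}"
proof -
  have "open ((\<lambda>p. (f p, g p)) -` D)"
    using open_D continuous_on_Pair [OF assms] by (rule open_vimage)
  then show ?thesis by (simp add: vimage_def)
qed

lemma AYBE_swapped:
  assumes "(x, u) \<in> D" "(y, u + v) \<in> D" "(x + y, u + v) \<in> D" "(- x, v) \<in> D" "(y, v) \<in> D" "(x + y, u) \<in> D"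
  shows "leg12 (R x u) ** leg13 (R y (u + v)) + leg13 (R (x + y) (u + v)) ** leg23 (R (- x) v) =
    leg23 (R y v) ** leg12 (R (x + y) u)"
proof -
  \<comment> \<open>Only the arguments visible in the relation restrict \<open>W\<close>; the
    further ones used in its derivation are confined to \<open>D4\<close>.\<close>
  define W where "W = {(x, y, u, v). (x, u) \<in> D \<and> (y, u + v) \<in> D \<and> (x + y, u + v) \<in> D \<and>
    (- x, v) \<in> D \<and> (y, v) \<in> D \<and> (x + y, u) \<in> D}"
  define F where "F = (\<lambda>(x, y, u, v). leg12 (R x u) ** leg13 (R y (u + v)) +
    leg13 (R (x + y) (u + v)) ** leg23 (R (- x) v))"
  define G where "G = (\<lambda>(x, y, u, v). leg23 (R y v) ** leg12 (R (x + y) u))"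
  have "F (x, y, u, v) = G (x, y, u, v)"
  proof (rule continuous_eq_on_dense [OF _ dense_D4])
    show "open W"
      unfolding W_def split_beta by (intro open_Collect_conj open_R_domain continuous_intros)
    show "continuous_on W F" "continuous_on W G"
      unfolding F_def G_def split_beta
      by (intro continuous_intros continuous_on_R; auto simp: W_def)+
    show "(x, y, u, v) \<in> W" using assms by (simp add: W_def)
    show "F p = G p" if "p \<in> D4" for p
    proof -
      obtain x y u v where p: "p = (x, y, u, v)" by (cases p)
      show ?thesis
        using AYBE_swapped_D0 [OF D4_D0(1)] that by (simp add: p F_def G_def)
    qed
  qed
  then show ?thesis by (simp add: F_def G_def)
qed

lemma cubic_wp:
  assumes "(x, u) \<in> D" "(y, u + v) \<in> D" "(x, v) \<in> D" "(y, v) \<in> D" "(x, u + v) \<in> D" "(y, u) \<in> D"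
    "(x + y, u + v) \<in> D" "x \<notin> pole_set \<kappa>" "y \<notin> pole_set \<kappa>"
  shows "leg12 (R x u) ** (leg13 (R y (u + v)) ** leg23 (R x v)) =
    leg23 (R y v) ** (leg13 (R x (u + v)) ** leg12 (R y u)) +
    (weierstrass_p \<kappa> x - weierstrass_p \<kappa> y) *\<^sub>m leg13 (R (x + y) (u + v))"
proof -
  define W where "W = {(x, y, u, v). (x, u) \<in> D \<and> (y, u + v) \<in> D \<and> (x, v) \<in> D \<and> (y, v) \<in> D \<and>
    (x, u + v) \<in> D \<and> (y, u) \<in> D \<and> (x + y, u + v) \<in> D \<and> x \<in> - pole_set \<kappa> \<and> y \<in> - pole_set \<kappa>}"
  define F where "F = (\<lambda>(x, y, u, v). leg12 (R x u) ** (leg13 (R y (u + v)) ** leg23 (R x v)))"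
  define G where "G = (\<lambda>(x, y, u, v). leg23 (R y v) ** (leg13 (R x (u + v)) ** leg12 (R y u)) +
    (weierstrass_p \<kappa> x - weierstrass_p \<kappa> y) *\<^sub>m leg13 (R (x + y) (u + v)))"
  have wp: "continuous_on W (\<lambda>p. weierstrass_p \<kappa> (f p))"
    if "continuous_on W f" "\<And>p. p \<in> W \<Longrightarrow> f p \<in> - pole_set \<kappa>" for f
    by (rule continuous_on_compose2 [OF continuous_on_weierstrass_p [OF adm] that(1)]) (use that(2) in blast)
  have pole: "open (f -` (- pole_set \<kappa>))" if "continuous_on UNIV f"
    for f :: "complex \<times> complex \<times> complex \<times> complex \<Rightarrow> complex"
    using generic_compl_pole_set [OF adm] that by (intro open_vimage) (auto simp: generic_def)
  have "F (x, y, u, v) = G (x, y, u, v)"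
  proof (rule continuous_eq_on_dense [OF _ dense_D4])
    show "open W"
      unfolding W_def split_beta
      by (intro open_Collect_conj open_R_domain continuous_intros pole [unfolded vimage_def])
    show "continuous_on W F" "continuous_on W G"
      unfolding F_def G_def split_beta
      by (intro continuous_intros continuous_on_R wp; auto simp: W_def)+
    show "(x, y, u, v) \<in> W" using assms by (simp add: W_def)
    show "F p = G p" if "p \<in> D4" for p
    proof -
      obtain x y u v where p: "p = (x, y, u, v)" by (cases p)
      show ?thesis
        using cubic_D0 [OF D4_D0(1) [OF that [unfolded p]]] by (simp add: p F_def G_def)
    qed
  qed
  then show ?thesis by (simp add: F_def G_def)
qed

text \<open>Both products of \<open>kronecker_phi\<close> contain \<wp>(h), which cancels. This is
  the form in which the scalar entries of the dynamical matrix deliver the coefficient.\<close>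

lemma cubic:
  assumes "(x, u) \<in> D" "(y, u + v) \<in> D" "(x, v) \<in> D" "(y, v) \<in> D" "(x, u + v) \<in> D" "(y, u) \<in> D"
    "(x + y, u + v) \<in> D" "x \<notin> pole_set \<kappa>" "y \<notin> pole_set \<kappa>" and h: "h \<notin> pole_set \<kappa>"
  shows "leg12 (R x u) ** (leg13 (R y (u + v)) ** leg23 (R x v)) =
    leg23 (R y v) ** (leg13 (R x (u + v)) ** leg12 (R y u)) +
      (kronecker_phi \<kappa> h y * kronecker_phi \<kappa> h (- y) - kronecker_phi \<kappa> h x * kronecker_phi \<kappa> h (- x)) *\<^sub>m
        leg13 (R (x + y) (u + v))"
  unfolding cubic_wp [OF assms(1-9)] kronecker_phi_product [OF adm h assms(8)] kronecker_phi_product [OF adm h assms(9)]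
  by simp

text \<open>The cubic relation at \<open>x = y\<close>, where its scalar vanishes. Continuity also
  reaches those \<open>h\<close> that are poles of \<wp> or for which
  \<open>R (2 * h) (u + v)\<close> is undefined. The variable \<open>y\<close> in \<open>W\<close>
  is a dummy that allows \<open>D4\<close> to be reused.\<close>

lemma YBE:
  assumes "(h, u) \<in> D" "(h, u + v) \<in> D" "(h, v) \<in> D"
  shows "leg12 (R h u) ** (leg13 (R h (u + v)) ** leg23 (R h v)) =
    leg23 (R h v) ** (leg13 (R h (u + v)) ** leg12 (R h u))"
proof -
  define W where "W = {(x :: complex, y :: complex, u, v). (x, u) \<in> D \<and> (x, u + v) \<in> D \<and> (x, v) \<in> D}"
  define F where "F = (\<lambda>(x, y :: complex, u, v). leg12 (R x u) ** (leg13 (R x (u + v)) ** leg23 (R x v)))"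
  define G where "G = (\<lambda>(x, y :: complex, u, v). leg23 (R x v) ** (leg13 (R x (u + v)) ** leg12 (R x u)))"
  have "F (h, 0, u, v) = G (h, 0, u, v)"
  proof (rule continuous_eq_on_dense [OF _ dense_D4])
    show "open W"
      unfolding W_def split_beta by (intro open_Collect_conj open_R_domain continuous_intros)
    show "continuous_on W F" "continuous_on W G"
      unfolding F_def G_def split_beta
      by (intro continuous_intros continuous_on_R; auto simp: W_def)+
    show "(h, 0, u, v) \<in> W" using assms by (simp add: W_def)
    show "F p = G p" if "p \<in> D4" for p
    proof -
      obtain x y u v where p: "p = (x, y, u, v)" by (cases p)
      show ?thesis
        using cubic_D0 [of x x u v, OF D4_D0(2) [OF that [unfolded p]]]
        by (simp add: p F_def G_def) (simp add: smult_mat_def vec_eq_iff)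
    qed
  qed
  then show ?thesis by (simp add: F_def G_def)
qed

end

subsection \<open>Block matrices\<close>

text \<open>Fixing the dynamical indices separates their combinatorics from the noncommutative
  algebra of the legs of \<open>R\<close>.\<close>

definition mblk :: "('p::finite \<times> 's::finite) cmat \<Rightarrow> 'p \<Rightarrow> 'p \<Rightarrow> 's cmat" where
  "mblk X p p' = (\<chi> s s'. X $ (p, s) $ (p', s'))"

lemma mblk_entry: "mblk X p p' $ s $ s' = X $ (p, s) $ (p', s')"
  by (simp add: mblk_def)

lemma mblk_eqI: "(\<And>p p'. mblk X p p' = mblk Y p p') \<Longrightarrow> X = Y"
  by (auto simp: vec_eq_iff mblk_def)

lemma mblk_mult: "mblk (X ** Y) p p' = (\<Sum>r\<in>UNIV. mblk X p r ** mblk Y r p')"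
  by (simp add: vec_eq_iff mblk_entry matrix_matrix_mult_def sum_component
      sum.cartesian_product UNIV_Times_UNIV [symmetric] split_beta del: UNIV_Times_UNIV)

lemma mblk_linear:
  "mblk (A + B) p p' = mblk A p p' + mblk B p p'"
  "mblk (c *\<^sub>m A) p p' = c *\<^sub>m mblk A p p'"
  "mblk (\<Sum>x\<in>S. f x) p p' = (\<Sum>x\<in>S. mblk (f x) p p')"
  by (simp_all add: vec_eq_iff mblk_entry smult_mat_def sum_component)

lemma mblk_tens: "mblk (A \<otimes>\<^sub>m B) p p' = A $ p $ p' *\<^sub>m B"
  by (simp add: vec_eq_iff mblk_entry tens_def smult_mat_def)

lemma mblk_one: "mblk (mat 1) p p' = (if p = p' then 1 else 0) *\<^sub>m mat 1"
  by (auto simp: vec_eq_iff mblk_entry mat_def smult_mat_def)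

lemma matrix_zero_mult: "0 ** A = 0" "A ** 0 = 0" for A :: "'i::finite cmat"
  by (simp_all add: matrix_matrix_mult_def vec_eq_iff)

lemma smult_mat_simps:
  "c *\<^sub>m (A + B) = c *\<^sub>m A + c *\<^sub>m B" "c *\<^sub>m (d *\<^sub>m A) = (c * d) *\<^sub>m A"
  "1 *\<^sub>m A = A" "0 *\<^sub>m A = 0" "c *\<^sub>m 0 = 0"
  by (simp_all add: vec_eq_iff smult_mat_def algebra_simps)

lemma tens_munit_entry:
  "(munit i j \<otimes>\<^sub>m munit k l) $ (a, b) $ (a', b') = (if a = i \<and> a' = j \<and> b = k \<and> b' = l then 1 else 0)"
  by (auto simp: tens_def munit_def)

text \<open>The ice rule: row \<open>(a, b)\<close> has nonzero blocks only in the columns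
  \<open>(a, b)\<close> and \<open>(b, a)\<close>.\<close>

lemma mblk_dynR:
  "mblk (dynR \<kappa> R h z w q) (a, b) (a', b') =
    (if a = b then (if a' = a \<and> b' = a then R h (z - w) else 0)
     else if a' = b \<and> b' = a then R (q $ a - q $ b) (z - w)
     else if a' = a \<and> b' = b then kronecker_phi \<kappa> h (q $ b - q $ a) *\<^sub>m mat 1 else 0)"
proof -
  have 1: "(\<Sum>i\<in>UNIV. mblk ((munit i i \<otimes>\<^sub>m munit i i) \<otimes>\<^sub>m R h (z - w)) (a, b) (a', b')) =
      (if a = b \<and> a' = a \<and> b' = a then R h (z - w) else 0)"
    by (subst sum_single [of _ a]) (auto simp: mblk_tens tens_munit_entry smult_mat_simps)
  have 2: "(\<Sum>(i, j)\<in>{(i, j). i \<noteq> j}. mblk ((munit i j \<otimes>\<^sub>m munit j i) \<otimes>\<^sub>m R (q $ i - q $ j) (z - w)) (a, b) (a', b')) =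
      (if a \<noteq> b \<and> a' = b \<and> b' = a then R (q $ a - q $ b) (z - w) else 0)"
  proof (cases "a = b")
    case True
    then show ?thesis
      by (intro trans [OF sum.neutral]) (auto simp: mblk_tens tens_munit_entry smult_mat_simps)
  next
    case False
    then show ?thesis
      by (subst sum_single [of _ "(a, b)"])
        (auto simp: mblk_tens tens_munit_entry smult_mat_simps split: if_splits)
  qed
  have 3: "(\<Sum>(i, j)\<in>{(i, j). i \<noteq> j}. mblk (kronecker_phi \<kappa> h (- (q $ i - q $ j)) *\<^sub>m
          ((munit i i \<otimes>\<^sub>m munit j j) \<otimes>\<^sub>m (mat 1 \<otimes>\<^sub>m mat 1))) (a, b) (a', b')) =
      (if a \<noteq> b \<and> a' = a \<and> b' = b then kronecker_phi \<kappa> h (q $ b - q $ a) *\<^sub>m mat 1 else 0)"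
  proof (cases "a = b")
    case True
    then show ?thesis
      by (intro trans [OF sum.neutral]) (auto simp: mblk_tens mblk_linear tens_munit_entry smult_mat_simps)
  next
    case False
    then show ?thesis
      by (subst sum_single [of _ "(a, b)"])
        (auto simp: mblk_tens mblk_linear tens_munit_entry smult_mat_simps tens_one split: if_splits)
  qed
  have "mblk (dynR \<kappa> R h z w q) (a, b) (a', b') =
      (if a = b \<and> a' = a \<and> b' = a then R h (z - w) else 0) +
      (if a \<noteq> b \<and> a' = b \<and> b' = a then R (q $ a - q $ b) (z - w) else 0) +
      (if a \<noteq> b \<and> a' = a \<and> b' = b then kronecker_phi \<kappa> h (q $ b - q $ a) *\<^sub>m mat 1 else 0)"
    unfolding dynR_def mblk_linear 1 [symmetric] 2 [symmetric] 3 [symmetric]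
    by (simp add: split_beta mblk_linear)
  then show ?thesis by auto
qed

lemma mblk_dleg:
  "mblk (dleg12 X) (a, b, c) (a', b', c') = (if c = c' then leg12 (mblk X (a, b) (a', b')) else 0)"
  "mblk (dleg13 X) (a, b, c) (a', b', c') = (if b = b' then leg13 (mblk X (a, c) (a', c')) else 0)"
  "mblk (dleg23 X) (a, b, c) (a', b', c') = (if a = a' then leg23 (mblk X (b, c) (b', c')) else 0)"
proof -
  have "dleg12 X $ ((a, b, c), (s, t, u)) $ ((a', b', c'), (s', t', u')) =
      (if c = c' then if u = u' then X $ ((a, b), (s, t)) $ ((a', b'), (s', t')) else 0 else 0)" for s t u s' t' u'
    unfolding dleg12_def sum_component
    by (subst sum_single [of _ "((a, a', b, b'), (s, s', t, t'))"])
      (auto simp: smult_mat_def tens_def munit_def mat_def split: if_splits)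
  then show "mblk (dleg12 X) (a, b, c) (a', b', c') = (if c = c' then leg12 (mblk X (a, b) (a', b')) else 0)"
    by (auto simp: vec_eq_iff mblk_entry leg_entry)
  have "dleg13 X $ ((a, b, c), (s, t, u)) $ ((a', b', c'), (s', t', u')) =
      (if b = b' then if t = t' then X $ ((a, c), (s, u)) $ ((a', c'), (s', u')) else 0 else 0)" for s t u s' t' u'
    unfolding dleg13_def sum_component
    by (subst sum_single [of _ "((a, a', c, c'), (s, s', u, u'))"])
      (auto simp: smult_mat_def tens_def munit_def mat_def split: if_splits)
  then show "mblk (dleg13 X) (a, b, c) (a', b', c') = (if b = b' then leg13 (mblk X (a, c) (a', c')) else 0)"
    by (auto simp: vec_eq_iff mblk_entry leg_entry)
  have "dleg23 X $ ((a, b, c), (s, t, u)) $ ((a', b', c'), (s', t', u')) =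
      (if a = a' then if s = s' then X $ ((b, c), (t, u)) $ ((b', c'), (t', u')) else 0 else 0)" for s t u s' t' u'
    unfolding dleg23_def sum_component
    by (subst sum_single [of _ "((b, b', c, c'), (t, t', u, u'))"])
      (auto simp: smult_mat_def tens_def munit_def mat_def split: if_splits)
  then show "mblk (dleg23 X) (a, b, c) (a', b', c') = (if a = a' then leg23 (mblk X (b, c) (b', c')) else 0)"
    by (auto simp: vec_eq_iff mblk_entry leg_entry)
qed

lemma sum_two:
  assumes "finite A" "a \<in> A" "b \<in> A" "\<And>x. x \<in> A \<Longrightarrow> x \<noteq> a \<Longrightarrow> x \<noteq> b \<Longrightarrow> f x = 0"
  shows "sum f A = (if a = b then f a else f b + f a)"
proof -
  have "sum f A = sum f {a, b}"
    using assms by (intro sum.mono_neutral_right) auto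
  then show ?thesis by (auto simp: add.commute)
qed

definition dq :: "complex ^ 'm \<Rightarrow> 'm::finite \<Rightarrow> 'm \<Rightarrow> complex" where
  "dq q i j = q $ i - q $ j"

lemma dq_axis: "dq (q + axis k t) i j = dq q i j + (if i = k then t else 0) - (if j = k then t else 0)"
  by (simp add: dq_def axis_def)

lemma dynR_definedD:
  assumes "dynR_defined \<kappa> D h z w q" "i \<noteq> j"
  shows "(dq q i j, z - w) \<in> D \<and> h \<notin> pole_set \<kappa> \<and> dq q i j \<notin> pole_set \<kappa>"
  using assms unfolding dynR_defined_def dq_def minus_in_pole_set_iff by blast

text \<open>With an arbitrary right factor \<open>Y\<close>, repeated use follows the row index
  through a product bracketed to the right, each factor either exchanging two indices or keeping
  them.\<close>

lemma mblk_dleg_dynR_mult: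
  fixes R :: "complex \<Rightarrow> complex \<Rightarrow> ('n::finite \<times> 'n) cmat"
  shows
  "mblk (dleg12 (dynR \<kappa> R h z w q) ** Y) (a, b, c) p' =
    (if a = b then leg12 (R h (z - w)) ** mblk Y (a, b, c) p'
     else leg12 (R (dq q a b) (z - w)) ** mblk Y (b, a, c) p' +
       kronecker_phi \<kappa> h (dq q b a) *\<^sub>m mblk Y (a, b, c) p')"
  "mblk (dleg13 (dynR \<kappa> R h z w q) ** Y) (a, b, c) p' =
    (if a = c then leg13 (R h (z - w)) ** mblk Y (a, b, c) p'
     else leg13 (R (dq q a c) (z - w)) ** mblk Y (c, b, a) p' +
       kronecker_phi \<kappa> h (dq q c a) *\<^sub>m mblk Y (a, b, c) p')"
  "mblk (dleg23 (dynR \<kappa> R h z w q) ** Y) (a, b, c) p' =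
    (if b = c then leg23 (R h (z - w)) ** mblk Y (a, b, c) p'
     else leg23 (R (dq q b c) (z - w)) ** mblk Y (a, c, b) p' +
       kronecker_phi \<kappa> h (dq q c b) *\<^sub>m mblk Y (a, b, c) p')"
proof -
  note simps = mblk_dleg mblk_dynR leg_linear smult_mult matrix_zero_mult dq_def
  show "mblk (dleg12 (dynR \<kappa> R h z w q) ** Y) (a, b, c) p' =
    (if a = b then leg12 (R h (z - w)) ** mblk Y (a, b, c) p'
     else leg12 (R (dq q a b) (z - w)) ** mblk Y (b, a, c) p' +
       kronecker_phi \<kappa> h (dq q b a) *\<^sub>m mblk Y (a, b, c) p')"
    unfolding mblk_mult by (subst sum_two [of _ "(a, b, c)" "(b, a, c)"]) (auto simp: simps split: if_splits)
  show "mblk (dleg13 (dynR \<kappa> R h z w q) ** Y) (a, b, c) p' =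
    (if a = c then leg13 (R h (z - w)) ** mblk Y (a, b, c) p'
     else leg13 (R (dq q a c) (z - w)) ** mblk Y (c, b, a) p' +
       kronecker_phi \<kappa> h (dq q c a) *\<^sub>m mblk Y (a, b, c) p')"
    unfolding mblk_mult by (subst sum_two [of _ "(a, b, c)" "(c, b, a)"]) (auto simp: simps split: if_splits)
  show "mblk (dleg23 (dynR \<kappa> R h z w q) ** Y) (a, b, c) p' =
    (if b = c then leg23 (R h (z - w)) ** mblk Y (a, b, c) p'
     else leg23 (R (dq q b c) (z - w)) ** mblk Y (a, c, b) p' +
       kronecker_phi \<kappa> h (dq q c b) *\<^sub>m mblk Y (a, b, c) p')"
    unfolding mblk_mult by (subst sum_two [of _ "(a, b, c)" "(a, c, b)"]) (auto simp: simps split: if_splits)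
qed

lemma mblk_E:
  "mblk (E1 k ** A) (a, b, c) p' = (if a = k then mblk A (a, b, c) p' else 0)"
  "mblk (E2 k ** A) (a, b, c) p' = (if b = k then mblk A (a, b, c) p' else 0)"
  "mblk (E3 k ** A) (a, b, c) p' = (if c = k then mblk A (a, b, c) p' else 0)"
  unfolding mblk_mult E1_def E2_def E3_def mblk_tens tens_one smult_mult matrix_mul_lid
  by (subst sum_single [of _ "(a, b, c)"]; auto simp: tens_def munit_def mat_def smult_mat_simps split: if_splits)+

text \<open>The projection onto the shifted component selects one summand: the shift is by the index
  that the current row carries there.\<close>

lemma mblk_dyn_shift_mult:
  "mblk (dyn_shift E1 h F q ** Y) (a, b, c) p' = mblk (F (q + axis a h) ** Y) (a, b, c) p'"
  "mblk (dyn_shift E2 h F q ** Y) (a, b, c) p' = mblk (F (q + axis b h) ** Y) (a, b, c) p'"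
  "mblk (dyn_shift E3 h F q ** Y) (a, b, c) p' = mblk (F (q + axis c h) ** Y) (a, b, c) p'"
  unfolding dyn_shift_def sum_mult mblk_linear matrix_mul_assoc [symmetric] mblk_E
  by (simp_all add: sum.delta)

section \<open>Comparison of the blocks, by coincidences among the three dynamical indices\<close>

context associative_YB
begin

text \<open>When one argument of the cubic relation is \<open>h\<close> itself, its coefficient is
  already a single product of \<open>kronecker_phi\<close>. This and the next lemma serve rows in
  which two neighbouring indices agree.\<close>

lemma cubic_left:
  assumes "(h, u) \<in> D" "(y, u + v) \<in> D" "(h, v) \<in> D" "(y, v) \<in> D" "(h, u + v) \<in> D" "(y, u) \<in> D"
    "(h + y, u + v) \<in> D" "h \<notin> pole_set \<kappa>" "y \<notin> pole_set \<kappa>"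
  shows "leg12 (R h u) ** (leg13 (R y (u + v)) ** leg23 (R h v)) =
    leg23 (R y v) ** (leg13 (R h (u + v)) ** leg12 (R y u)) +
      (kronecker_phi \<kappa> h y * kronecker_phi \<kappa> h (- y)) *\<^sub>m leg13 (R (h + y) (u + v))"
  unfolding cubic_wp [OF assms] kronecker_phi_product [OF adm assms(8,9)] ..

lemma cubic_right:
  assumes "(x, u) \<in> D" "(h, u + v) \<in> D" "(x, v) \<in> D" "(h, v) \<in> D" "(x, u + v) \<in> D" "(h, u) \<in> D"
    "(x + h, u + v) \<in> D" "x \<notin> pole_set \<kappa>" "h \<notin> pole_set \<kappa>"
  shows "leg12 (R x u) ** (leg13 (R h (u + v)) ** leg23 (R x v)) =
    leg23 (R h v) ** (leg13 (R x (u + v)) ** leg12 (R h u)) +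
      (- kronecker_phi \<kappa> h x * kronecker_phi \<kappa> h (- x)) *\<^sub>m leg13 (R (x + h) (u + v))"
  unfolding cubic_wp [OF assms] mult_minus_left kronecker_phi_product [OF adm assms(9,8)] by simp

text \<open>\<open>Y\<close> stands for the identity; its weights \<open>d p\<close> label the final
  column, so all columns of a row are treated together. For distinct indices, the columns reached by
  two exchanges give the associative equation or its image, times a common scalar. The column
  \<open>(c, b, a)\<close> is reached by three exchanges, or by one exchange of the outer components
  between two scalar steps, and gives the cubic relation.\<close>

lemma dynamical_YBE_block:
  fixes q :: "complex ^ 'm::finite"
  assumes z: "z1 - z2 = u" "z2 - z3 = v" "z1 - z3 = u + v"
    and h: "\<And>t. t \<in> {u, v, u + v} \<Longrightarrow> (h, t) \<in> D"
    and q: "\<And>i j s t. i \<noteq> j \<Longrightarrow> s \<in> {0, h, - h} \<Longrightarrow> t \<in> {u, v, u + v} \<Longrightarrow> (dq q i j + s, t) \<in> D"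
    and poles: "\<And>i j s. i \<noteq> j \<Longrightarrow> s \<in> {0, h, - h} \<Longrightarrow> h \<notin> pole_set \<kappa> \<and> dq q i j + s \<notin> pole_set \<kappa>"
    and Y: "\<And>p. mblk Y p p' = d p *\<^sub>m mat 1"
  shows "mblk (dleg12 (dynR \<kappa> R h z1 z2 q) **
    (dyn_shift E2 (- h) (\<lambda>q. dleg13 (dynR \<kappa> R h z1 z3 q)) q **
    (dleg23 (dynR \<kappa> R h z2 z3 q) ** Y))) (a, b, c) p' =
    mblk (dyn_shift E1 (- h) (\<lambda>q. dleg23 (dynR \<kappa> R h z2 z3 q)) q **
    (dleg13 (dynR \<kappa> R h z1 z3 q) **
    (dyn_shift E3 (- h) (\<lambda>q. dleg12 (dynR \<kappa> R h z1 z2 q)) q ** Y))) (a, b, c) p'"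
proof -
  note expand = mblk_dleg_dynR_mult mblk_dyn_shift_mult dq_axis z Y smult_mult matrix_add_mult smult_mat_simps
  have q0: "(dq q i j, t) \<in> D" "(dq q i j + h, t) \<in> D" "(dq q i j - h, t) \<in> D"
    if "i \<noteq> j" "t \<in> {u, v, u + v}" for i j t
    using q [OF that(1) _ that(2), of 0] q [OF that(1) _ that(2), of h] q [OF that(1) _ that(2), of "- h"] by auto
  have p0: "dq q i j \<notin> pole_set \<kappa>" "dq q i j + h \<notin> pole_set \<kappa>" "dq q i j - h \<notin> pole_set \<kappa>" "h \<notin> pole_set \<kappa>"
    if "i \<noteq> j" for i j
    using poles [OF that, of 0] poles [OF that, of h] poles [OF that, of "- h"] by auto
  consider "a = b" "b = c" | "a = b" "b \<noteq> c" | "c = a" "a \<noteq> b" | "c = b" "a \<noteq> b" | "a \<noteq> b" "b \<noteq> c" "a \<noteq> c"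
    by blast
  then show ?thesis
  proof cases
    case 1
    then show ?thesis
      using YBE [OF h h h, of u v] by (simp add: expand)
  next
    case 2
    \<comment> \<open>As \<open>a = b\<close>, the shift in component 2 turns
      \<open>dq q a c\<close> into \<open>x - h\<close>. The cubic relation is used at
      \<open>h\<close> and \<open>x - h\<close>, whose sum is \<open>x\<close>.\<close>
    define x where "x = dq q b c"
    have x: "dq q b c = x" "dq q c b = - x" by (simp_all add: x_def dq_def)
    have D: "(x, t) \<in> D" "(x - h, t) \<in> D" "(h - x, t) \<in> D" if "t \<in> {u, v, u + v}" for t
      using q0 [of b c, OF _ that] q0 [of c b, OF _ that] 2 by (simp_all add: x)
    have P: "x - h \<notin> pole_set \<kappa>" "h \<notin> pole_set \<kappa>"
      using p0 [of b c] 2 by (simp_all add: x)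
    have "leg12 (R h u) ** leg23 (R x v) =
        leg13 (R x (u + v)) ** leg12 (R (h - x) u) + leg23 (R (x - h) v) ** leg13 (R h (u + v))"
      using h D by (intro AYBE') auto
    moreover have "leg12 (R h u) ** (leg13 (R (x - h) (u + v)) ** leg23 (R h v)) =
        leg23 (R (x - h) v) ** (leg13 (R h (u + v)) ** leg12 (R (x - h) u)) +
        (kronecker_phi \<kappa> h (x - h) * kronecker_phi \<kappa> h (h - x)) *\<^sub>m leg13 (R x (u + v))"
      using cubic_left [of h u "x - h" v] h D P by simp
    ultimately show ?thesis
      using 2 by (simp add: expand x) (simp add: smult_mat_def vec_eq_iff algebra_simps)
  next
    case 3
    \<comment> \<open>After the exchange of \<open>a\<close> and \<open>b\<close> the row is
      \<open>(b, a, a)\<close>, and the shift by the index \<open>a\<close> turns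
      \<open>dq q b a\<close> into \<open>h - x\<close>. The cubic relation is used at
      \<open>x\<close> and \<open>h - x\<close>, with sum \<open>h\<close>.\<close>
    define x where "x = dq q a b"
    have x: "dq q a b = x" "dq q b a = - x" by (simp_all add: x_def dq_def)
    have D: "(x, t) \<in> D" "(x - h, t) \<in> D" "(h - x, t) \<in> D" "(- x, t) \<in> D" if "t \<in> {u, v, u + v}" for t
      using q0 [of a b, OF _ that] q0 [of b a, OF _ that] 3 by (simp_all add: x)
    have P: "x \<notin> pole_set \<kappa>" "h - x \<notin> pole_set \<kappa>" "h \<notin> pole_set \<kappa>"
      using p0 [of a b] p0 [of b a] 3 by (simp_all add: x)
    have "leg12 (R x u) ** leg23 (R h v) =
        leg13 (R h (u + v)) ** leg12 (R (x - h) u) + leg23 (R (h - x) v) ** leg13 (R x (u + v))"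
      using h D by (intro AYBE') auto
    moreover have "leg23 (R (h - x) v) ** leg12 (R h u) =
        leg12 (R x u) ** leg13 (R (h - x) (u + v)) + leg13 (R h (u + v)) ** leg23 (R (- x) v)"
      using AYBE_swapped [of x u "h - x" v] h D by simp
    moreover have "leg12 (R x u) ** (leg13 (R (h - x) (u + v)) ** leg23 (R x v)) =
        leg23 (R (h - x) v) ** (leg13 (R x (u + v)) ** leg12 (R (h - x) u)) +
        (kronecker_phi \<kappa> h (h - x) * kronecker_phi \<kappa> h (x - h) -
         kronecker_phi \<kappa> h x * kronecker_phi \<kappa> h (- x)) *\<^sub>m leg13 (R h (u + v))"
      using cubic [of x u "h - x" v h] h D P by simp
    ultimately show ?thesis
      using 3 by (simp add: expand x) (simp add: smult_mat_def vec_eq_iff algebra_simps)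
  next
    case 4
    \<comment> \<open>If the first factor exchanges nothing, the shift by the index \<open>b\<close>
      turns \<open>dq q a c\<close> into \<open>x + h\<close>. Now \<open>h\<close> is the second
      argument of the cubic relation.\<close>
    define x where "x = dq q a b"
    have x: "dq q a b = x" "dq q b a = - x" by (simp_all add: x_def dq_def)
    have D: "(x, t) \<in> D" "(x + h, t) \<in> D" "(- x, t) \<in> D" if "t \<in> {u, v, u + v}" for t
      using q0 [of a b, OF _ that] q0 [of b a, OF _ that] 4 by (simp_all add: x)
    have P: "x \<notin> pole_set \<kappa>" "h \<notin> pole_set \<kappa>"
      using p0 [of a b] 4 by (simp_all add: x)
    have "leg23 (R h v) ** leg12 (R (x + h) u) =
        leg12 (R x u) ** leg13 (R h (u + v)) + leg13 (R (x + h) (u + v)) ** leg23 (R (- x) v)"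
      using AYBE_swapped [of x u h v] h D by simp
    moreover have "leg12 (R x u) ** (leg13 (R h (u + v)) ** leg23 (R x v)) =
        leg23 (R h v) ** (leg13 (R x (u + v)) ** leg12 (R h u)) +
        (- kronecker_phi \<kappa> h x * kronecker_phi \<kappa> h (- x)) *\<^sub>m leg13 (R (x + h) (u + v))"
      using cubic_right [of x u h v] h D P by simp
    ultimately show ?thesis
      using 4 by (simp add: expand x) (simp add: smult_mat_def vec_eq_iff algebra_simps)
  next
    case 5
    \<comment> \<open>Each shift is by an index different from the two on which the shifted factor
      acts, so every argument stays unshifted.\<close>
    define x where "x = dq q a b"
    define y where "y = dq q b c"
    have xy: "dq q a b = x" "dq q b a = - x" "dq q b c = y" "dq q c b = - y" "dq q a c = x + y"
      by (simp_all add: x_def y_def dq_def)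
    have D: "(x, t) \<in> D" "(y, t) \<in> D" "(x + y, t) \<in> D" "(- x, t) \<in> D" "(- y, t) \<in> D" if "t \<in> {u, v, u + v}" for t
      using q0(1) [of a b, OF _ that] q0(1) [of b a, OF _ that] q0(1) [of b c, OF _ that]
        q0(1) [of c b, OF _ that] q0(1) [of a c, OF _ that] 5 by (simp_all add: xy)
    have P: "x \<notin> pole_set \<kappa>" "y \<notin> pole_set \<kappa>" "h \<notin> pole_set \<kappa>"
      using p0 [of a b] p0 [of b c] 5 by (simp_all add: xy)
    have "leg12 (R x u) ** leg23 (R (x + y) v) =
        leg13 (R (x + y) (u + v)) ** leg12 (R (- y) u) + leg23 (R y v) ** leg13 (R x (u + v))"
      using AYBE' [of x u "x + y" v] D by simp
    moreover have "leg23 (R y v) ** leg12 (R (x + y) u) =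
        leg12 (R x u) ** leg13 (R y (u + v)) + leg13 (R (x + y) (u + v)) ** leg23 (R (- x) v)"
      using AYBE_swapped [of x u y v] D by simp
    moreover have "leg12 (R x u) ** (leg13 (R y (u + v)) ** leg23 (R x v)) =
        leg23 (R y v) ** (leg13 (R x (u + v)) ** leg12 (R y u)) +
        (kronecker_phi \<kappa> h y * kronecker_phi \<kappa> h (- y) -
         kronecker_phi \<kappa> h x * kronecker_phi \<kappa> h (- x)) *\<^sub>m leg13 (R (x + y) (u + v))"
      using cubic [of x u y v h] D P by simp
    ultimately show ?thesis
      using 5 by (simp add: expand xy) (simp add: smult_mat_def vec_eq_iff algebra_simps)
  qed
qed

end

theorem mainTheorem1:
  fixes \<kappa> :: fun_type
    and R :: "complex \<Rightarrow> complex \<Rightarrow> ('n::finite \<times> 'n) cmat"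
    and D :: "(complex \<times> complex) set"
  assumes "admissible \<kappa>"
    \<comment> \<open>\<open>D\<close> is where \<open>R\<close> is defined: for meromorphic \<open>R\<close>, the complement of its polar set\<close>
    and "open D" and "closure D = UNIV" and "continuous_on D (\<lambda>(h, z). R h z)"
    and associative_YBE: "\<And>h \<eta> z1 z2 z3.
      \<lbrakk>(h, z1 - z2) \<in> D; (\<eta>, z2 - z3) \<in> D; (\<eta>, z1 - z3) \<in> D; (h - \<eta>, z1 - z2) \<in> D;
        (\<eta> - h, z2 - z3) \<in> D; (h, z1 - z3) \<in> D\<rbrakk> \<Longrightarrow>
      leg12 (R h (z1 - z2)) ** leg23 (R \<eta> (z2 - z3)) =
        leg13 (R \<eta> (z1 - z3)) ** leg12 (R (h - \<eta>) (z1 - z2)) +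
        leg23 (R (\<eta> - h) (z2 - z3)) ** leg13 (R h (z1 - z3))"
    and skew_symmetry: "\<And>h z. \<lbrakk>(h, z) \<in> D; (- h, - z) \<in> D\<rbrakk> \<Longrightarrow>
      R h z = - leg21 (R (- h) (- z))"
    and unitarity: "\<And>h z. \<lbrakk>(h, z) \<in> D; (h, - z) \<in> D; h \<notin> pole_set \<kappa>; z \<notin> pole_set \<kappa>\<rbrakk> \<Longrightarrow>
      R h z ** leg21 (R h (- z)) =
        (weierstrass_p \<kappa> h - weierstrass_p \<kappa> z) *\<^sub>m (mat 1 \<otimes>\<^sub>m mat 1)"
  shows "\<forall>h z1 z2 z3 (q :: complex ^ 'm::finite).
    (\<forall>(z, w)\<in>{(z1, z2), (z1, z3), (z2, z3)}.
       dynR_defined \<kappa> D h z w q \<and> (\<forall>k. dynR_defined \<kappa> D h z w (q + axis k (- h)))) \<longrightarrow>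
    dleg12 (dynR \<kappa> R h z1 z2 q) **
    dyn_shift E2 (- h) (\<lambda>q. dleg13 (dynR \<kappa> R h z1 z3 q)) q **
    dleg23 (dynR \<kappa> R h z2 z3 q) =
    dyn_shift E1 (- h) (\<lambda>q. dleg23 (dynR \<kappa> R h z2 z3 q)) q **
    dleg13 (dynR \<kappa> R h z1 z3 q) **
    dyn_shift E3 (- h) (\<lambda>q. dleg12 (dynR \<kappa> R h z1 z2 q)) q"
proof (intro allI impI)
  fix h z1 z2 z3 and q :: "complex ^ 'm"
  assume defined: "\<forall>(z, w)\<in>{(z1, z2), (z1, z3), (z2, z3)}.
    dynR_defined \<kappa> D h z w q \<and> (\<forall>k. dynR_defined \<kappa> D h z w (q + axis k (- h)))"
  interpret associative_YB \<kappa> R D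
    by unfold_locales (fact assms)+
  let ?A = "dleg12 (dynR \<kappa> R h z1 z2 q)"
    and ?B = "dyn_shift E2 (- h) (\<lambda>q. dleg13 (dynR \<kappa> R h z1 z3 q)) q"
    and ?C = "dleg23 (dynR \<kappa> R h z2 z3 q)"
    and ?A' = "dyn_shift E3 (- h) (\<lambda>q. dleg12 (dynR \<kappa> R h z1 z2 q)) q"
    and ?B' = "dleg13 (dynR \<kappa> R h z1 z3 q)"
    and ?C' = "dyn_shift E1 (- h) (\<lambda>q. dleg23 (dynR \<kappa> R h z2 z3 q)) q"
  define u where "u = z1 - z2"
  define v where "v = z2 - z3"
  have z: "z1 - z2 = u" "z2 - z3 = v" "z1 - z3 = u + v" by (simp_all add: u_def v_def)
  have def0: "dynR_defined \<kappa> D h t 0 q" "dynR_defined \<kappa> D h t 0 (q + axis k (- h))" if "t \<in> {u, v, u + v}" for t k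
    using defined that by (auto simp: dynR_defined_def z)
  have D: "(h, t) \<in> D" if "t \<in> {u, v, u + v}" for t
    using def0(1) [OF that] by (simp add: dynR_defined_def)
  \<comment> \<open>Parameters are only ever lowered by \<open>h\<close>: lowering
    \<open>q $ i\<close> gives \<open>dq q i j - h\<close>, and lowering \<open>q $ j\<close> gives
    \<open>dq q i j + h\<close>.\<close>
  have Dq: "(dq q i j + s, t) \<in> D \<and> h \<notin> pole_set \<kappa> \<and> dq q i j + s \<notin> pole_set \<kappa>"
    if "i \<noteq> j" "s \<in> {0, h, - h}" "t \<in> {u, v, u + v}" for i j s t
    using diff_0_right [of t] dynR_definedD [OF def0(1) [OF that(3)] that(1)] dynR_definedD [OF def0(2) [OF that(3), of i] that(1)]
      dynR_definedD [OF def0(2) [OF that(3), of j] that(1)] that(1,2)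
    by (auto simp: dq_axis)
  have poles: "h \<notin> pole_set \<kappa> \<and> dq q i j + s \<notin> pole_set \<kappa>" if "i \<noteq> j" "s \<in> {0, h, - h}" for i j s
    using Dq [OF that, of u] by simp
  \<comment> \<open>The trailing identity serves as \<open>Y\<close>; its weights are Kronecker
    deltas.\<close>
  have "?A ** (?B ** (?C ** mat 1)) = ?C' ** (?B' ** (?A' ** mat 1))"
  proof (rule mblk_eqI)
    fix p p' :: "'m \<times> 'm \<times> 'm"
    obtain a b c where p: "p = (a, b, c)" by (cases p)
    show "mblk (?A ** (?B ** (?C ** mat 1))) p p' = mblk (?C' ** (?B' ** (?A' ** mat 1))) p p'"
      unfolding p by (rule dynamical_YBE_block [OF z D _ poles mblk_one]) (use Dq in blast)+
  qed
  then show "?A ** ?B ** ?C = ?C' ** ?B' ** ?A'"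
    by (simp add: matrix_mul_assoc)
qed

end
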